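(* Let $\Gamma$ and $\Gamma'$ be connected strongly regular graphs with parameters $(n,k,a,c)$ and $(n',k',a',c')$ and vertex sets $X$, $X'$ respectively. Then $\Gamma$ and $\Gamma'$ are $T$-isomorphic if and only if both (i) $(n,k,a,c)=(n',k',a',c')$, and (ii) for every pair of vertices $x\in X$ and $x'\in X'$, the local graph $\Delta_1(x)$ of $\Gamma$ and the local graph $\Delta'_1(x')$ of $\Gamma'$ have the same spectrum.
   Context: A strongly regular graph with parameters $(n,k,a,c)$ is a $k$-regular graph on $n$ vertices in which every pair of adjacent vertices has exactly $a$ common neighbours and every pair of distinct non-adjacent vertices has exactly $c$ common neighbours. For a graph $\Gamma$ with vertex set $X$, distance $\partial$, diameter $D$ and $x\in X$, $\Delta_1(x)$ is the subgraph induced on the neighbours of $x$. Let $V=\mathbb{C}^X$, $A$ the adjacency matrix, and $E^*_i(x)$ ($0\le i\le D$) the diagonal matrix with $(E^*_i(x))_{yy}=1$ if $\partial(x,y)=i$ and $0$ otherwise; $T(x)$ is the subalgebra of $\mathrm{Mat}_X(\mathbb{C})$ generated by $A,E^*_0(x),\dots,E^*_D(x)$. Use primes for the same objects of $\Gamma'$ (vertex set $X'$, $V'=\mathbb{C}^{X'}$, $A'$, $E'^*_i(x')$, $T'(x')$). Two such graphs of the same diameter $D$ are $T$-isomorphic if for every $x\in X$ and $x'\in X'$: $|X|=|X'|$, there is a $\mathbb{C}$-algebra isomorphism $f:T(x)\to T'(x')$ with $f(A)=A'$ and $f(E^*_i(x))=E'^*_i(x')$ for all $i$, and there is a $\mathbb{C}$-linear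 bijection $\rho:V\to V'$ with $\rho B=f(B)\rho$ for all $B\in T(x)$.
   Formalization: Strongly regular graphs are required to have an edge and a pair of distinct non-adjacent vertices; for complete graphs c is arbitrary (K_3 with (3,2,1,0) and (3,2,1,1) is T-isomorphic to itself), and for a single vertex so is a, so the claim fails there. *)

theory Defs
  imports "Jordan_Normal_Form.Char_Poly" "HOL-Computational_Algebra.Polynomial"
begin

definition simple_graph :: "'a set \<Rightarrow> ('a \<Rightarrow> 'a \<Rightarrow> bool) \<Rightarrow> bool" where
  "simple_graph X E \<longleftrightarrow> finite X \<and> (\<forall>x y. E x y \<longrightarrow> x \<in> X \<and> y \<in> X)
     \<and> (\<forall>x y. E x y \<longrightarrow> E y x) \<and> (\<forall>x. \<not> E x x)"

definition nbhd :: "'a set \<Rightarrow> ('a \<Rightarrow> 'a \<Rightarrow> bool) \<Rightarrow> 'a \<Rightarrow> 'a set" where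
  "nbhd X E x = {y \<in> X. E x y}"

definition walk_betw :: "'a set \<Rightarrow> ('a \<Rightarrow> 'a \<Rightarrow> bool) \<Rightarrow> 'a \<Rightarrow> 'a \<Rightarrow> nat \<Rightarrow> bool" where
  "walk_betw X E x y n \<longleftrightarrow> (\<exists>xs. length xs = Suc n \<and> hd xs = x \<and> last xs = y \<and> set xs \<subseteq> X
      \<and> (\<forall>i<n. E (xs ! i) (xs ! Suc i)))"

definition connected_graph :: "'a set \<Rightarrow> ('a \<Rightarrow> 'a \<Rightarrow> bool) \<Rightarrow> bool" where
  "connected_graph X E \<longleftrightarrow> (\<forall>x\<in>X. \<forall>y\<in>X. \<exists>n. walk_betw X E x y n)"

definition gdist :: "'a set \<Rightarrow> ('a \<Rightarrow> 'a \<Rightarrow> bool) \<Rightarrow> 'a \<Rightarrow> 'a \<Rightarrow> nat" where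
  "gdist X E x y = (LEAST n. walk_betw X E x y n)"

definition diameter :: "'a set \<Rightarrow> ('a \<Rightarrow> 'a \<Rightarrow> bool) \<Rightarrow> nat" where
  "diameter X E = Max {gdist X E x y | x y. x \<in> X \<and> y \<in> X}"

text \<open>Strongly regular graph with parameters (n,k,a,c). Following the usual convention
  (Brouwer--Van Maldeghem), a strongly regular graph is required to be neither complete nor
  edgeless (otherwise c, resp. a, is not determined by the graph).\<close>
definition strongly_regular :: "'a set \<Rightarrow> ('a \<Rightarrow> 'a \<Rightarrow> bool) \<Rightarrow> nat \<Rightarrow> nat \<Rightarrow> nat \<Rightarrow> nat \<Rightarrow> bool" where
  "strongly_regular X E n k a c \<longleftrightarrow> simple_graph X E \<and> card X = n
     \<and> (\<forall>x\<in>X. card (nbhd X E x) = k)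
     \<and> (\<forall>x\<in>X. \<forall>y\<in>X. E x y \<longrightarrow> card (nbhd X E x \<inter> nbhd X E y) = a)
     \<and> (\<forall>x\<in>X. \<forall>y\<in>X. x \<noteq> y \<and> \<not> E x y \<longrightarrow> card (nbhd X E x \<inter> nbhd X E y) = c)
     \<and> (\<exists>x y. E x y) \<and> (\<exists>x\<in>X. \<exists>y\<in>X. x \<noteq> y \<and> \<not> E x y)"

section \<open>Matrices in Mat_X(C) and vectors in C^X, as functions supported on X\<close>

definition vecs :: "'a set \<Rightarrow> ('a \<Rightarrow> complex) set" where
  "vecs X = {v. \<forall>y. y \<notin> X \<longrightarrow> v y = 0}"

definition mmult :: "'a set \<Rightarrow> ('a \<Rightarrow> 'a \<Rightarrow> complex) \<Rightarrow> ('a \<Rightarrow> 'a \<Rightarrow> complex) \<Rightarrow> ('a \<Rightarrow> 'a \<Rightarrow> complex)" where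
  "mmult X M N = (\<lambda>y z. \<Sum>w\<in>X. M y w * N w z)"

definition mvmult :: "'a set \<Rightarrow> ('a \<Rightarrow> 'a \<Rightarrow> complex) \<Rightarrow> ('a \<Rightarrow> complex) \<Rightarrow> ('a \<Rightarrow> complex)" where
  "mvmult X M v = (\<lambda>y. \<Sum>z\<in>X. M y z * v z)"

definition adj_mat :: "'a set \<Rightarrow> ('a \<Rightarrow> 'a \<Rightarrow> bool) \<Rightarrow> ('a \<Rightarrow> 'a \<Rightarrow> complex)" where
  "adj_mat X E = (\<lambda>y z. if y \<in> X \<and> z \<in> X \<and> E y z then 1 else 0)"

definition dual_idem :: "'a set \<Rightarrow> ('a \<Rightarrow> 'a \<Rightarrow> bool) \<Rightarrow> 'a \<Rightarrow> nat \<Rightarrow> ('a \<Rightarrow> 'a \<Rightarrow> complex)" where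
  "dual_idem X E x i = (\<lambda>y z. if y = z \<and> y \<in> X \<and> gdist X E x y = i then 1 else 0)"

inductive_set T_alg :: "'a set \<Rightarrow> ('a \<Rightarrow> 'a \<Rightarrow> bool) \<Rightarrow> 'a \<Rightarrow> ('a \<Rightarrow> 'a \<Rightarrow> complex) set"
  for X E x where
  gen_A: "adj_mat X E \<in> T_alg X E x"
| gen_E: "i \<le> diameter X E \<Longrightarrow> dual_idem X E x i \<in> T_alg X E x"
| add: "M \<in> T_alg X E x \<Longrightarrow> N \<in> T_alg X E x \<Longrightarrow> (\<lambda>y z. M y z + N y z) \<in> T_alg X E x"
| smult: "M \<in> T_alg X E x \<Longrightarrow> (\<lambda>y z. s * M y z) \<in> T_alg X E x"
| mult: "M \<in> T_alg X E x \<Longrightarrow> N \<in> T_alg X E x \<Longrightarrow> mmult X M N \<in> T_alg X E x"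

definition T_isomorphic :: "'a set \<Rightarrow> ('a \<Rightarrow> 'a \<Rightarrow> bool) \<Rightarrow> 'b set \<Rightarrow> ('b \<Rightarrow> 'b \<Rightarrow> bool) \<Rightarrow> bool" where
  "T_isomorphic X E X' E' \<longleftrightarrow> diameter X E = diameter X' E' \<and>
    (\<forall>x\<in>X. \<forall>x'\<in>X'. card X = card X' \<and>
      (\<exists>f. bij_betw f (T_alg X E x) (T_alg X' E' x')
        \<and> (\<forall>M\<in>T_alg X E x. \<forall>N\<in>T_alg X E x. f (\<lambda>y z. M y z + N y z) = (\<lambda>y z. f M y z + f N y z))
        \<and> (\<forall>s. \<forall>M\<in>T_alg X E x. f (\<lambda>y z. s * M y z) = (\<lambda>y z. s * f M y z))
        \<and> (\<forall>M\<in>T_alg X E x. \<forall>N\<in>T_alg X E x. f (mmult X M N) = mmult X' (f M) (f N))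
        \<and> f (adj_mat X E) = adj_mat X' E'
        \<and> (\<forall>i\<le>diameter X E. f (dual_idem X E x i) = dual_idem X' E' x' i)
        \<and> (\<exists>\<rho>. bij_betw \<rho> (vecs X) (vecs X')
            \<and> (\<forall>u\<in>vecs X. \<forall>v\<in>vecs X. \<rho> (\<lambda>y. u y + v y) = (\<lambda>y. \<rho> u y + \<rho> v y))
            \<and> (\<forall>s. \<forall>v\<in>vecs X. \<rho> (\<lambda>y. s * v y) = (\<lambda>y. s * \<rho> v y))
            \<and> (\<forall>B\<in>T_alg X E x. \<forall>v\<in>vecs X. \<rho> (mvmult X B v) = mvmult X' (f B) (\<rho> v)))))"

definition local_adj :: "'a set \<Rightarrow> ('a \<Rightarrow> 'a \<Rightarrow> bool) \<Rightarrow> 'a \<Rightarrow> complex mat" where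
  "local_adj X E x = (let vs = (SOME vs. distinct vs \<and> set vs = nbhd X E x) in
     mat (length vs) (length vs) (\<lambda>(i, j). if E (vs ! i) (vs ! j) then 1 else 0))"

definition local_spectrum :: "'a set \<Rightarrow> ('a \<Rightarrow> 'a \<Rightarrow> bool) \<Rightarrow> 'a \<Rightarrow> complex multiset" where
  "local_spectrum X E x = proots (char_poly (local_adj X E x))"

end

theory Submission
  imports Defs
begin

text \<open>If \<open>\<Gamma>\<close> and \<open>\<Gamma>'\<close> are \<open>T\<close>-isomorphic, the numbers \<open>(A\<^sup>m)\<^sub>x\<^sub>x\<close> for \<open>m = 2, 3, 4\<close> agree and
  determine the parameters, and \<open>\<rho>\<close> restricts to a map conjugating the local adjacency matrices.

  Conversely it suffices to find a linear bijection intertwining \<open>A\<close> with \<open>A'\<close> and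
  \<open>E\<^sup>*\<^sub>i\<close> with \<open>E'\<^sup>*\<^sub>i\<close>, since conjugation by it then gives the algebra isomorphism. It is
  obtained by matching orthogonal bases made of the indicators of the three spheres around
  \<open>x\<close>, eigenvectors \<open>u\<close> of the local graph orthogonal to the all-ones vector, the nonzero
  projections \<open>w = E\<^sup>*\<^sub>2 A u\<close>, and eigenvectors of \<open>A\<close> on the orthogonal complement of all these.
  The relation \<open>A\<^sup>2 = k I + a A + c (J - I - A)\<close> shows that \<open>A\<close> acts on the pair \<open>u, w\<close> by a matrix
  depending only on the local eigenvalue and the parameters, and that the remaining eigenvalues are
  roots of one quadratic polynomial; their multiplicities follow from the dimension and the
  trace of \<open>A\<close>.\<close>

section \<open>Orthogonal bases and self-adjoint operators\<close>

text \<open>Condition (ii) supplies only a multiset of numbers, while an intertwining map needs the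
  joint action of \<open>A\<close> and the three sphere projections. The matrix J sees only the sum
  of the entries of a vector, so it disappears from \<open>A\<^sup>2\<close> on vectors orthogonal
  to the all-ones vector, leaving the quadratic t^2 = (a - c) t + (k - c). Evaluated at a local
  eigenvalue, this quadratic is, up to sign and conjugation, the factor \<open>srg_mu\<close>
  between inner products of the \<open>w\<close> and those of the \<open>u\<close>. Hence the
  \<open>w\<close> are again orthogonal, even within a repeated eigenvalue, and \<open>w\<close>
  vanishes exactly when the local eigenvalue is a root. So the spectrum alone decides which
  \<open>w\<close> enter the basis, and both graphs can use one index set. The local graph is
  a-regular: the all-ones vector accounts for one copy of a, and removing it from both spectra
  leaves equal spectra on the orthogonal complements. In the other direction, c enters the closed
  walk numbers only at length four, as c^2 times the number of vertices at distance two, which is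
  positive.\<close>

definition subsp :: "('a \<Rightarrow> complex) set \<Rightarrow> bool" where
  "subsp S \<longleftrightarrow> (\<lambda>_. 0) \<in> S \<and> (\<forall>u\<in>S. \<forall>v\<in>S. \<forall>s t. (\<lambda>y. s * u y + t * v y) \<in> S)"

definition lin_on :: "('a \<Rightarrow> complex) set \<Rightarrow> (('a \<Rightarrow> complex) \<Rightarrow> ('b \<Rightarrow> complex)) \<Rightarrow> bool" where
  "lin_on S H \<longleftrightarrow> (\<forall>u\<in>S. \<forall>v\<in>S. \<forall>s t. H (\<lambda>y. s * u y + t * v y) = (\<lambda>y. s * H u y + t * H v y))"

definition ip :: "'a set \<Rightarrow> ('a \<Rightarrow> complex) \<Rightarrow> ('a \<Rightarrow> complex) \<Rightarrow> complex" where
  "ip X u v = (\<Sum>y\<in>X. cnj (u y) * v y)"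

text \<open>Completeness is stated as the absence of a nonzero vector of \<open>S\<close> orthogonal
  to the family; the expansion follows in \<open>orth_basis_expand\<close>. The family is indexed so
  that bases of two graphs can share an index set, and it is not normalised.\<close>

definition orth_basis ::
  "'a set \<Rightarrow> ('a \<Rightarrow> complex) set \<Rightarrow> 'i set \<Rightarrow> ('i \<Rightarrow> 'a \<Rightarrow> complex) \<Rightarrow> bool" where
  "orth_basis X S I b \<longleftrightarrow> finite I \<and> (\<forall>i\<in>I. b i \<in> S \<and> b i \<noteq> (\<lambda>_. 0))
     \<and> (\<forall>i\<in>I. \<forall>j\<in>I. i \<noteq> j \<longrightarrow> ip X (b i) (b j) = 0)
     \<and> (\<forall>v\<in>S. (\<forall>i\<in>I. ip X (b i) v = 0) \<longrightarrow> v = (\<lambda>_. 0))"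

lemma subsp_comb: "subsp S \<Longrightarrow> u \<in> S \<Longrightarrow> v \<in> S \<Longrightarrow> (\<lambda>y. s * u y + t * v y) \<in> S"
  by (simp add: subsp_def)

lemma subsp_smult: "subsp S \<Longrightarrow> u \<in> S \<Longrightarrow> (\<lambda>y. s * u y) \<in> S"
  using subsp_comb[of S u u s 0] by simp

lemma subsp_sum:
  assumes "subsp S" "\<And>i. i \<in> I \<Longrightarrow> f i \<in> S"
  shows "(\<lambda>y. \<Sum>i\<in>I. r i * f i y) \<in> S"
  using assms(2)
proof (induction I rule: infinite_finite_induct)
  case (insert i I)
  have "(\<lambda>y. r i * f i y + 1 * (\<Sum>i\<in>I. r i * f i y)) \<in> S"
    using insert by (intro subsp_comb assms(1)) auto
  with insert show ?case by simp
qed (use assms(1) in \<open>auto simp: subsp_def\<close>)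

lemma lin_on_comb: "lin_on S H \<Longrightarrow> u \<in> S \<Longrightarrow> v \<in> S \<Longrightarrow>
    H (\<lambda>y. s * u y + t * v y) = (\<lambda>y. s * H u y + t * H v y)"
  by (simp add: lin_on_def)

lemma lin_on_smult: "lin_on S H \<Longrightarrow> u \<in> S \<Longrightarrow> H (\<lambda>y. s * u y) = (\<lambda>y. s * H u y)"
  using lin_on_comb[of S H u u s 0] by simp

lemma lin_on_add: "lin_on S H \<Longrightarrow> u \<in> S \<Longrightarrow> v \<in> S \<Longrightarrow>
    H (\<lambda>y. u y + v y) = (\<lambda>y. H u y + H v y)"
  using lin_on_comb[of S H u v 1 1] by simp

lemma lin_on_zero: "subsp S \<Longrightarrow> lin_on S H \<Longrightarrow> H (\<lambda>_. 0) = (\<lambda>_. 0)"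
  using lin_on_smult[of S H "\<lambda>_. 0" 0] by (simp add: subsp_def)

lemma lin_on_sum:
  assumes "subsp S" "lin_on S H" "\<And>i. i \<in> I \<Longrightarrow> f i \<in> S"
  shows "H (\<lambda>y. \<Sum>i\<in>I. r i * f i y) = (\<lambda>y. \<Sum>i\<in>I. r i * H (f i) y)"
  using assms(3)
proof (induction I rule: infinite_finite_induct)
  case (insert i I)
  have "H (\<lambda>y. r i * f i y + 1 * (\<Sum>i\<in>I. r i * f i y))
      = (\<lambda>y. r i * H (f i) y + 1 * H (\<lambda>y. \<Sum>i\<in>I. r i * f i y) y)"
    using insert by (intro lin_on_comb[OF assms(2)] subsp_sum assms(1)) auto
  with insert show ?case by simp
qed (use lin_on_zero[OF assms(1,2)] in auto)

lemma subsp_vecs: "subsp (vecs X)"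
  by (auto simp: subsp_def vecs_def)

lemma ip_comb_right: "ip X u (\<lambda>y. s * v y + t * w y) = s * ip X u v + t * ip X u w"
  by (simp add: ip_def sum.distrib sum_distrib_left algebra_simps)

lemma ip_comb_left: "ip X (\<lambda>y. s * v y + t * w y) u = cnj s * ip X v u + cnj t * ip X w u"
  by (simp add: ip_def sum.distrib sum_distrib_left algebra_simps)

lemma ip_smult_right: "ip X u (\<lambda>y. s * v y) = s * ip X u v"
  using ip_comb_right[of X u s v 0 v] by simp

lemma ip_smult_left: "ip X (\<lambda>y. s * v y) u = cnj s * ip X v u"
  using ip_comb_left[of X s v 0 v] by simp

lemma ip_sum_right: "ip X u (\<lambda>y. \<Sum>i\<in>I. r i * f i y) = (\<Sum>i\<in>I. r i * ip X u (f i))"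
  by (simp add: ip_def sum_distrib_left sum.swap[of _ X I] algebra_simps)

lemma ip_zero [simp]: "ip X u (\<lambda>_. 0) = 0" "ip X (\<lambda>_. 0) u = 0"
  by (simp_all add: ip_def)

lemma ip_cnj: "cnj (ip X u v) = ip X v u"
  by (simp add: ip_def mult.commute)

lemma ip_eq_0_sym: "ip X u v = 0 \<Longrightarrow> ip X v u = 0"
  by (metis ip_cnj complex_cnj_zero)

lemma ip_self_eq_0:
  assumes "finite X" "v \<in> vecs X" "ip X v v = 0"
  shows "v = (\<lambda>_. 0)"
proof -
  have "ip X v v = of_real (\<Sum>y\<in>X. (cmod (v y))\<^sup>2)"
    unfolding ip_def of_real_sum by (intro sum.cong) (simp_all only: complex_norm_square mult.commute)
  with assms(3) have "(\<Sum>y\<in>X. (cmod (v y))\<^sup>2) = 0"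
    by (metis of_real_eq_0_iff)
  then have "\<forall>y\<in>X. v y = 0"
    using assms(1) by (subst (asm) sum_nonneg_eq_0_iff) auto
  with assms(2) show ?thesis by (auto simp: vecs_def)
qed

lemma ip_superset:
  assumes "finite X" "Y \<subseteq> X" "u \<in> vecs Y"
  shows "ip X u v = ip Y u v"
  unfolding ip_def using assms by (intro sum.mono_neutral_right) (auto simp: vecs_def)

lemma ip_disjoint:
  assumes "u \<in> vecs Y" "v \<in> vecs Z" "Y \<inter> Z = {}"
  shows "ip X u v = 0"
  unfolding ip_def using assms by (intro sum.neutral) (auto simp: vecs_def)

section \<open>Linear dependence and the existence of eigenvectors\<close>

text \<open>Gaussian elimination, one coordinate at a time: either all functions vanish at the new
  coordinate, or one of them serves as pivot and is spent on clearing it from the others.\<close>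

lemma linear_dependence:
  fixes f :: "'i \<Rightarrow> 'a \<Rightarrow> complex"
  assumes "finite X" "finite I" "card X < card I"
  shows "\<exists>r. (\<exists>i\<in>I. r i \<noteq> 0) \<and> (\<forall>y\<in>X. (\<Sum>i\<in>I. r i * f i y) = 0)"
  using assms
proof (induction X arbitrary: I f rule: finite_induct)
  case empty
  then obtain i where "i \<in> I" by fastforce
  then show ?case by (intro exI[of _ "\<lambda>_. 1"]) auto
next
  case (insert z X)
  show ?case
  proof (cases "\<forall>i\<in>I. f i z = 0")
    case True
    with insert.IH[of I f] insert.prems insert.hyps show ?thesis by auto
  next
    case False
    then obtain j where j: "j \<in> I" "f j z \<noteq> 0" by auto
    define g where "g = (\<lambda>i y. f i y - f i z / f j z * f j y)"
    have "card X < card (I - {j})" using insert j by simp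
    with insert.IH[of "I - {j}" g] insert.prems obtain r where
      r: "\<exists>i\<in>I - {j}. r i \<noteq> 0" "\<forall>y\<in>X. (\<Sum>i\<in>I - {j}. r i * g i y) = 0"
      by auto
    \<comment> \<open>The relation found for the reduced functions \<open>g\<close> is rewritten in
      terms of \<open>f\<close>; the multiples of the pivot \<open>f j\<close> collect into the
      single coefficient \<open>- s\<close>.\<close>
    define s where "s = (\<Sum>i\<in>I - {j}. r i * (f i z / f j z))"
    define r' where "r' = r(j := - s)"
    have sum: "(\<Sum>i\<in>I. r' i * f i y) = (\<Sum>i\<in>I - {j}. r i * g i y)" for y
    proof -
      have "(\<Sum>i\<in>I. r' i * f i y) = - s * f j y + (\<Sum>i\<in>I - {j}. r i * f i y)"
        using insert.prems j unfolding r'_def by (subst sum.remove[of _ j]) auto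
      also have "\<dots> = (\<Sum>i\<in>I - {j}. r i * g i y)"
        unfolding s_def g_def right_diff_distrib sum_subtractf
        by (simp add: sum_distrib_right mult.assoc)
      finally show ?thesis .
    qed
    have "(\<Sum>i\<in>I. r' i * f i z) = 0"
      unfolding sum using j by (simp add: g_def)
    moreover have "\<exists>i\<in>I. r' i \<noteq> 0" using r(1) by (auto simp: r'_def)
    ultimately show ?thesis using r(2) sum by (intro exI[of _ r']) auto
  qed
qed

text \<open>Pairing a linear relation with a member whose coefficient is nonzero isolates its
  squared norm. The bound makes the maximality argument in \<open>self_adjoint_eigenbasis\<close>
  possible.\<close>

lemma card_orthogonal_le:
  assumes "finite X" "finite I" and b: "\<And>i. i \<in> I \<Longrightarrow> b i \<in> vecs X \<and> b i \<noteq> (\<lambda>_. 0)"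
    and orth: "\<And>i j. i \<in> I \<Longrightarrow> j \<in> I \<Longrightarrow> i \<noteq> j \<Longrightarrow> ip X (b i) (b j) = 0"
  shows "card I \<le> card X"
proof (rule ccontr)
  assume "\<not> card I \<le> card X"
  then obtain r i where r: "i \<in> I" "r i \<noteq> 0" "\<forall>y\<in>X. (\<Sum>i\<in>I. r i * b i y) = 0"
    using linear_dependence[of X I b] assms(1,2) by auto
  have "0 = ip X (b i) (\<lambda>y. \<Sum>j\<in>I. r j * b j y)"
    using r(3) by (simp add: ip_def)
  also have "\<dots> = (\<Sum>j\<in>I. if j = i then r i * ip X (b i) (b i) else 0)"
    unfolding ip_sum_right using r(1) orth by (intro sum.cong) auto
  also have "\<dots> = r i * ip X (b i) (b i)" using r(1) assms(2) by simp
  finally show False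
    using r ip_self_eq_0[of X "b i"] b assms(1) by auto
qed

text \<open>Splitting off a root \<open>l\<close> of \<open>p\<close>, the vector (H - l) v is
  either zero, so that \<open>v\<close> is an eigenvector, or a nonzero vector of \<open>S\<close>
  annihilated by the cofactor \<open>q\<close>, which has smaller degree.\<close>

lemma poly_annihilated_imp_eigenvector:
  assumes S: "subsp S" and H: "lin_on S H" "\<And>v. v \<in> S \<Longrightarrow> H v \<in> S"
    and v: "v \<in> S" "v \<noteq> (\<lambda>_. 0)" and p: "p \<noteq> 0" "degree p \<le> N"
    and ann: "\<And>y. (\<Sum>i\<le>N. coeff p i * (H ^^ i) v y) = 0"
  shows "\<exists>w\<in>S. w \<noteq> (\<lambda>_. 0) \<and> (\<exists>l. H w = (\<lambda>y. l * w y))"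
  using v p ann
proof (induction N arbitrary: p v)
  case 0
  then obtain y where "v y \<noteq> 0" by auto
  moreover have "coeff p 0 \<noteq> 0" using 0(3,4) leading_coeff_0_iff[of p] by simp
  ultimately show ?case using 0(5)[of y] by simp
next
  case (Suc N)
  show ?case
  proof (cases "degree p = 0")
    case True
    then have c: "coeff p i = 0" if "i > 0" for i using that by (simp add: coeff_eq_0)
    from Suc.prems(2) obtain y where "v y \<noteq> 0" by auto
    moreover have "coeff p 0 \<noteq> 0" using Suc.prems(3) True by (metis leading_coeff_0_iff)
    moreover have "(\<Sum>i\<le>Suc N. coeff p i * (H ^^ i) v y) = coeff p 0 * v y"
      by (subst sum.atMost_Suc_shift) (simp add: c)
    ultimately show ?thesis using Suc.prems(5)[of y] by simp
  next
    case False
    then obtain l where "poly p l = 0"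
      using fundamental_theorem_of_algebra[of p] by (auto simp: constant_degree)
    then obtain q where q: "p = [:-l, 1:] * q" by (auto simp: poly_eq_0_iff_dvd)
    have q0: "q \<noteq> 0" using Suc q by auto
    then have dq: "degree p = Suc (degree q)" unfolding q by (subst degree_mult_eq) auto
    then have qN: "coeff q (Suc N) = 0" using Suc.prems(4) by (intro coeff_eq_0) simp
    define u where "u = (\<lambda>y. 1 * H v y + (-l) * v y)"
    have uS: "u \<in> S" unfolding u_def using Suc H(2) by (intro subsp_comb S) auto
    show ?thesis
    proof (cases "u = (\<lambda>_. 0)")
      case True
      then have "H v = (\<lambda>y. l * v y)" by (auto simp: u_def fun_eq_iff)
      with Suc.prems show ?thesis by auto
    next
      case False
      have HS: "(H ^^ i) w \<in> S" if "w \<in> S" for w i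
        using that by (induction i) (auto intro: H(2))
      have Hu: "(H ^^ i) u = (\<lambda>y. 1 * (H ^^ Suc i) v y + (-l) * (H ^^ i) v y)" for i
      proof (induction i)
        case (Suc i)
        then show ?case
          using lin_on_comb[OF H(1) HS HS, OF \<open>v \<in> S\<close> \<open>v \<in> S\<close>, of 1 "Suc i" "-l" i] by simp
      qed (simp add: u_def)
      have "(\<Sum>i\<le>N. coeff q i * (H ^^ i) u y) = 0" for y
      proof -
        have "(\<Sum>i\<le>Suc N. coeff p i * (H ^^ i) v y)
          = (\<Sum>i\<le>Suc N. - l * (coeff q i * (H ^^ i) v y))
            + (\<Sum>i\<le>Suc N. coeff (pCons 0 q) i * (H ^^ i) v y)"
          unfolding sum.distrib[symmetric] q by (intro sum.cong) (auto simp: algebra_simps)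
        also have "(\<Sum>i\<le>Suc N. coeff (pCons 0 q) i * (H ^^ i) v y)
            = (\<Sum>i\<le>N. coeff q i * (H ^^ Suc i) v y)"
          by (subst sum.atMost_Suc_shift) simp
        also have "(\<Sum>i\<le>Suc N. - l * (coeff q i * (H ^^ i) v y))
            = (\<Sum>i\<le>N. - l * (coeff q i * (H ^^ i) v y))" using qN by simp
        finally have "(\<Sum>i\<le>N. - l * (coeff q i * (H ^^ i) v y)) + (\<Sum>i\<le>N. coeff q i * (H ^^ Suc i) v y) = 0"
          using Suc.prems(5)[of y] by (simp only:)
        then show ?thesis
          unfolding Hu sum.distrib[symmetric] by (simp only: mult_1 distrib_left mult_minus_left
              mult_minus_right mult.left_commute[of l] add.commute)
      qed
      with Suc.IH[OF uS False q0] dq Suc.prems(4) show ?thesis by simp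
    qed
  qed
qed

text \<open>The vectors v, H v, ..., H^N v with N = \<open>card X\<close> are N + 1 functions on N
  points, so a nonzero polynomial in \<open>H\<close> annihilates \<open>v\<close>.\<close>

lemma eigenvector_exists:
  assumes "finite X" and S: "subsp S" "S \<subseteq> vecs X" and H: "lin_on S H" "\<And>v. v \<in> S \<Longrightarrow> H v \<in> S"
    and v: "v \<in> S" "v \<noteq> (\<lambda>_. 0)"
  shows "\<exists>w\<in>S. w \<noteq> (\<lambda>_. 0) \<and> (\<exists>l. H w = (\<lambda>y. l * w y))"
proof -
  let ?N = "card X"
  obtain r j where r: "j \<le> ?N" "r j \<noteq> 0" "\<forall>y\<in>X. (\<Sum>i\<le>?N. r i * (H ^^ i) v y) = 0"
    using linear_dependence[of X "{..?N}" "\<lambda>i. (H ^^ i) v"] assms(1) by auto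
  define p where "p = (\<Sum>i\<le>?N. monom (r i) i)"
  have coeff: "coeff p i = (if i \<le> ?N then r i else 0)" for i
    unfolding p_def coeff_sum by (simp add: coeff_monom)
  have HS: "(H ^^ i) v \<in> S" for i using v by (induction i) (auto intro: H(2))
  have "(\<Sum>i\<le>?N. coeff p i * (H ^^ i) v y) = 0" for y
  proof (cases "y \<in> X")
    case True
    with r(3) show ?thesis by (simp add: coeff)
  next
    case False
    then have "(H ^^ i) v y = 0" for i using HS[of i] S(2) by (auto simp: vecs_def)
    then show ?thesis by simp
  qed
  moreover have "p \<noteq> 0" using coeff[of j] r by auto
  moreover have "degree p \<le> ?N" by (intro degree_le) (auto simp: coeff)
  ultimately show ?thesis
    using poly_annihilated_imp_eigenvector[OF S(1) H v, of p ?N] by blast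
qed

text \<open>A largest orthogonal set of eigenvectors is complete. Its orthogonal complement in
  \<open>S\<close> is invariant, since self-adjointness moves \<open>H\<close> onto an eigenvector
  \<open>b\<close> and leaves a multiple of a zero inner product. A nonzero complement would thus
  contain one more eigenvector. The basis is indexed by its own vectors.\<close>

lemma self_adjoint_eigenbasis:
  assumes X: "finite X" and S: "subsp S" "S \<subseteq> vecs X"
    and H: "lin_on S H" "\<And>v. v \<in> S \<Longrightarrow> H v \<in> S"
    and sa: "\<And>u v. u \<in> S \<Longrightarrow> v \<in> S \<Longrightarrow> ip X u (H v) = ip X (H u) v"
  shows "\<exists>B ev. orth_basis X S B (\<lambda>b. b) \<and> (\<forall>b\<in>B. H b = (\<lambda>y. ev b * b y))"
proof -
  define good where "good B \<longleftrightarrow> finite B \<and> (\<forall>b\<in>B. b \<in> S \<and> b \<noteq> (\<lambda>_. 0) \<and> (\<exists>l. H b = (\<lambda>y. l * b y)))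
    \<and> (\<forall>b\<in>B. \<forall>b'\<in>B. b \<noteq> b' \<longrightarrow> ip X b b' = 0)" for B
  have bound: "card B < Suc (card X)" if "good B" for B
    using card_orthogonal_le[OF X, of B "\<lambda>b. b"] that S(2) unfolding good_def by fastforce
  have "good {}" by (simp add: good_def)
  then obtain B where B: "good B" and max: "\<And>B'. good B' \<Longrightarrow> card B' \<le> card B"
    using ex_has_greatest_nat[of good "{}" card "Suc (card X)"] bound by auto
  have "v = (\<lambda>_. 0)" if v: "v \<in> S" "\<forall>b\<in>B. ip X b v = 0" for v
  proof (rule ccontr)
    assume "v \<noteq> (\<lambda>_. 0)"
    define S' where "S' = {v \<in> S. \<forall>b\<in>B. ip X b v = 0}"
    have "subsp S'" unfolding subsp_def S'_def
      using S(1) by (auto simp: ip_comb_right intro: subsp_comb) (simp add: subsp_def)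
    moreover have "S' \<subseteq> vecs X" using S(2) by (auto simp: S'_def)
    moreover have "lin_on S' H" using H(1) by (auto simp: lin_on_def S'_def)
    moreover have "H w \<in> S'" if "w \<in> S'" for w
    proof -
      have "ip X b (H w) = 0" if b: "b \<in> B" for b
      proof -
        obtain l where l: "H b = (\<lambda>y. l * b y)" "b \<in> S" using B[unfolded good_def, THEN conjunct2, THEN conjunct1, rule_format, OF b] by blast
        with sa[of b w] \<open>w \<in> S'\<close> b show ?thesis by (simp add: S'_def ip_smult_left)
      qed
      with that H(2) show ?thesis by (simp add: S'_def)
    qed
    ultimately obtain w l where w: "w \<in> S'" "w \<noteq> (\<lambda>_. 0)" "H w = (\<lambda>y. l * w y)"
      using eigenvector_exists[of X S' H v] X v \<open>v \<noteq> _\<close> by (auto simp: S'_def)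
    have wB: "w \<notin> B"
      using w ip_self_eq_0[OF X, of w] S(2) by (auto simp: S'_def)
    have wb: "ip X b w = 0" "ip X w b = 0" if "b \<in> B" for b
      using w(1) that ip_eq_0_sym[of X b w] by (simp_all add: S'_def)
    have "good (insert w B)"
      unfolding good_def
    proof (intro conjI ballI impI)
      fix b assume "b \<in> insert w B"
      then show "b \<in> S" "b \<noteq> (\<lambda>_. 0)" "\<exists>l. H b = (\<lambda>y. l * b y)"
        using B[unfolded good_def] w by (auto simp: S'_def)
    next
      fix b b' assume "b \<in> insert w B" "b' \<in> insert w B" "b \<noteq> b'"
      then show "ip X b b' = 0" using B[unfolded good_def] wb by auto
    qed (use B in \<open>simp add: good_def\<close>)
    from max[OF this] wB B show False by (simp add: good_def)
  qed
  moreover obtain ev where "\<forall>b\<in>B. H b = (\<lambda>y. ev b * b y)"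
    using B[unfolded good_def, THEN conjunct2, THEN conjunct1] by metis
  moreover have "finite B" "\<forall>b\<in>B. b \<in> S \<and> b \<noteq> (\<lambda>_. 0)" "\<forall>b\<in>B. \<forall>b'\<in>B. b \<noteq> b' \<longrightarrow> ip X b b' = 0"
    using B unfolding good_def by meson+
  ultimately have "orth_basis X S B (\<lambda>b. b) \<and> (\<forall>b\<in>B. H b = (\<lambda>y. ev b * b y))"
    unfolding orth_basis_def by simp
  then show ?thesis by blast
qed

section \<open>Expansion, trace and dimension in an orthogonal basis\<close>

lemma orth_basis_coeff:
  assumes "finite X" "orth_basis X S I b" "S \<subseteq> vecs X" "i \<in> I"
  shows "ip X (b i) (b i) \<noteq> 0"
  using assms ip_self_eq_0[of X "b i"] by (auto simp: orth_basis_def)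

lemma orth_basis_ip_sum:
  assumes X: "finite X" and b: "orth_basis X S I b" "S \<subseteq> vecs X" "i \<in> I"
  shows "ip X (b i) (\<lambda>y. \<Sum>j\<in>I. r j * b j y) = r i * ip X (b i) (b i)"
proof -
  have "ip X (b i) (\<lambda>y. \<Sum>j\<in>I. r j * b j y) = (\<Sum>j\<in>I. if j = i then r i * ip X (b i) (b i) else 0)"
    unfolding ip_sum_right using b by (intro sum.cong) (auto simp: orth_basis_def)
  with b show ?thesis by (simp add: orth_basis_def)
qed

lemma orth_basis_expand:
  assumes X: "finite X" and b: "orth_basis X S I b" "subsp S" "S \<subseteq> vecs X" and v: "v \<in> S"
  shows "v = (\<lambda>y. \<Sum>i\<in>I. (ip X (b i) v / ip X (b i) (b i)) * b i y)"
proof -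
  let ?s = "\<lambda>y. \<Sum>i\<in>I. (ip X (b i) v / ip X (b i) (b i)) * b i y"
  have s: "?s \<in> S" using b by (intro subsp_sum) (auto simp: orth_basis_def)
  have "ip X (b i) (\<lambda>y. 1 * v y + (-1) * ?s y) = 0" if "i \<in> I" for i
    unfolding ip_comb_right orth_basis_ip_sum[OF X b(1,3) that]
    using orth_basis_coeff[OF X b(1,3) that] by simp
  moreover have "(\<lambda>y. 1 * v y + (-1) * ?s y) \<in> S" using b v s by (intro subsp_comb) auto
  ultimately have "(\<lambda>y. 1 * v y + (-1) * ?s y) = (\<lambda>_. 0)"
    using b(1) unfolding orth_basis_def by blast
  then show ?thesis by (simp add: fun_eq_iff)
qed

text \<open>The left side sums the diagonal coefficients of \<open>M\<close> in the basis
  \<open>b\<close>; it equals the trace because the rank-one projections onto the \<open>b i\<close>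
  add up to the identity.\<close>

lemma orth_basis_trace:
  assumes X: "finite X" and b: "orth_basis X (vecs X) I b"
  shows "(\<Sum>i\<in>I. ip X (b i) (mvmult X M (b i)) / ip X (b i) (b i)) = (\<Sum>y\<in>X. M y y)"
proof -
  \<comment> \<open>Resolution of the identity, read off from the expansion of the standard basis
    vector \<open>d\<close> at \<open>y\<close>.\<close>
  have delta: "(\<Sum>i\<in>I. cnj (b i y) * b i z / ip X (b i) (b i)) = (if z = y then 1 else 0)"
    if "y \<in> X" for y z
  proof -
    define d :: "'a \<Rightarrow> complex" where "d = (\<lambda>z. if z = y then 1 else 0)"
    have "d \<in> vecs X" using that by (auto simp: d_def vecs_def)
    moreover have "ip X u d = cnj (u y)" for u
      using X that by (simp add: ip_def d_def if_distrib[of "(*) _"] cong: if_cong)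
    ultimately show ?thesis
      using fun_cong[OF orth_basis_expand[OF X b subsp_vecs subset_refl, of d], of z]
      by (simp add: d_def)
  qed
  have "(\<Sum>i\<in>I. ip X (b i) (mvmult X M (b i)) / ip X (b i) (b i))
      = (\<Sum>i\<in>I. \<Sum>y\<in>X. \<Sum>z\<in>X. M y z * (cnj (b i y) * b i z / ip X (b i) (b i)))"
    unfolding ip_def[of _ _ "mvmult _ _ _"]
    unfolding mvmult_def sum_distrib_left sum_divide_distrib
    by (intro sum.cong refl) (simp only: times_divide_eq_right mult.left_commute)
  also have "\<dots> = (\<Sum>y\<in>X. \<Sum>z\<in>X. M y z * (\<Sum>i\<in>I. cnj (b i y) * b i z / ip X (b i) (b i)))"
    unfolding sum_distrib_left by (subst sum.swap, rule sum.cong[OF refl], rule sum.swap)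
  also have "\<dots> = (\<Sum>y\<in>X. M y y)"
    using X by (intro sum.cong) (simp_all add: delta if_distrib[of "(*) _"] cong: if_cong)
  finally show ?thesis .
qed

text \<open>The trace formula applied to the identity matrix counts the basis on one side and
  \<open>X\<close> on the other.\<close>

lemma orth_basis_card:
  assumes X: "finite X" and b: "orth_basis X (vecs X) I b"
  shows "card I = card X"
proof -
  define M :: "'a \<Rightarrow> 'a \<Rightarrow> complex" where "M = (\<lambda>y z. if z = y then 1 else 0)"
  have "ip X (b i) (mvmult X M (b i)) = ip X (b i) (b i)" for i
    using X by (auto simp: ip_def mvmult_def M_def if_distrib[of "\<lambda>x. x * _"] intro!: sum.cong cong: if_cong)
  then have "(\<Sum>i\<in>I. ip X (b i) (mvmult X M (b i)) / ip X (b i) (b i)) = of_nat (card I)"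
    using orth_basis_coeff[OF X b subset_refl] by simp
  then have "(of_nat (card I) :: complex) = of_nat (card X)"
    unfolding orth_basis_trace[OF X b] by (simp add: M_def)
  then show ?thesis by simp
qed

section \<open>Intertwining maps and characteristic polynomials\<close>

lemma lin_on_mvmult: "lin_on S (mvmult X M)"
  by (simp add: lin_on_def mvmult_def sum.distrib sum_distrib_left algebra_simps)

lemma mvmult_mmult: "mvmult X (mmult X M N) v = mvmult X M (mvmult X N v)"
proof
  fix y
  have "mvmult X (mmult X M N) v y = (\<Sum>z\<in>X. \<Sum>w\<in>X. M y w * (N w z * v z))"
    by (simp add: mvmult_def mmult_def sum_distrib_right mult.assoc)
  also have "\<dots> = mvmult X M (mvmult X N v) y"
    unfolding mvmult_def sum_distrib_left by (rule sum.swap)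
  finally show "mvmult X (mmult X M N) v y = mvmult X M (mvmult X N v) y" .
qed

definition ind :: "'a set \<Rightarrow> 'a \<Rightarrow> complex" where
  "ind Y = (\<lambda>y. if y \<in> Y then 1 else 0)"

lemma ind_vecs: "Y \<subseteq> X \<Longrightarrow> ind Y \<in> vecs X"
  by (auto simp: ind_def vecs_def)

lemma mvmult_ind_single: "finite X \<Longrightarrow> z \<in> X \<Longrightarrow> mvmult X M (ind {z}) = (\<lambda>y. M y z)"
  by (simp add: mvmult_def ind_def if_distrib[of "(*) _"] cong: if_cong)

lemma ind_expand:
  assumes "finite X" "v \<in> vecs X"
  shows "v = (\<lambda>y. \<Sum>z\<in>X. v z * ind {z} y)"
proof
  fix y
  show "v y = (\<Sum>z\<in>X. v z * ind {z} y)"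
    using assms by (cases "y \<in> X") (auto simp: ind_def vecs_def if_distrib[of "(*) _"] cong: if_cong)
qed

text \<open>Matrices are functions on the whole type. Vanishing outside \<open>X\<close> makes
  equality of functions agree with equality in the matrix algebra, and hence with equality of the
  actions on \<open>vecs X\<close>.\<close>

definition mats :: "'a set \<Rightarrow> ('a \<Rightarrow> 'a \<Rightarrow> complex) set" where
  "mats X = {M. \<forall>y z. y \<notin> X \<or> z \<notin> X \<longrightarrow> M y z = 0}"

lemma mats_eqI:
  assumes "finite X" "M \<in> mats X" "N \<in> mats X"
    and eq: "\<And>v. v \<in> vecs X \<Longrightarrow> mvmult X M v = mvmult X N v"
  shows "M = N"
proof (intro ext)
  fix y z
  show "M y z = N y z"
  proof (cases "z \<in> X")
    case True
    with fun_cong[OF eq[OF ind_vecs, of "{z}"], of y] assms(1)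
    show ?thesis by (simp add: mvmult_ind_single)
  next
    case False
    with assms(2,3) show ?thesis by (simp add: mats_def)
  qed
qed

lemma mvmult_vecs: "M \<in> mats X \<Longrightarrow> mvmult X M v \<in> vecs X"
  by (auto simp: mats_def vecs_def mvmult_def)

lemma mats_closed:
  "M \<in> mats X \<Longrightarrow> N \<in> mats X \<Longrightarrow> (\<lambda>y z. M y z + N y z) \<in> mats X"
  "M \<in> mats X \<Longrightarrow> (\<lambda>y z. s * M y z) \<in> mats X"
  "M \<in> mats X \<Longrightarrow> N \<in> mats X \<Longrightarrow> mmult X M N \<in> mats X"
  by (auto simp: mats_def mmult_def)

lemma mvmult_add: "mvmult X (\<lambda>y z. M y z + N y z) v = (\<lambda>y. mvmult X M v y + mvmult X N v y)"
  by (simp add: mvmult_def sum.distrib algebra_simps)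

lemma mvmult_smult: "mvmult X (\<lambda>y z. s * M y z) v = (\<lambda>y. s * mvmult X M v y)"
  by (simp add: mvmult_def sum_distrib_left algebra_simps)

lemma adj_mat_mats: "adj_mat X E \<in> mats X"
  by (simp add: mats_def adj_mat_def)

lemma dual_idem_mats: "dual_idem X E x i \<in> mats X"
  by (auto simp: mats_def dual_idem_def)

lemma T_alg_mats: "M \<in> T_alg X E x \<Longrightarrow> M \<in> mats X"
proof (induction rule: T_alg.induct)
qed (auto intro: mats_closed simp: adj_mat_mats dual_idem_mats)

section \<open>Conjugation of matrices by a linear isomorphism\<close>

text \<open>The inverse is carried along explicitly because conjugation uses both maps and the roles
  of the two graphs get exchanged.\<close>

definition lin_iso ::
  "'a set \<Rightarrow> 'b set \<Rightarrow> (('a \<Rightarrow> complex) \<Rightarrow> 'b \<Rightarrow> complex) \<Rightarrow> (('b \<Rightarrow> complex) \<Rightarrow> 'a \<Rightarrow> complex) \<Rightarrow> bool" where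
  "lin_iso X X' \<rho> \<sigma> \<longleftrightarrow> lin_on (vecs X) \<rho> \<and> lin_on (vecs X') \<sigma>
     \<and> (\<forall>v\<in>vecs X. \<rho> v \<in> vecs X' \<and> \<sigma> (\<rho> v) = v) \<and> (\<forall>v\<in>vecs X'. \<sigma> v \<in> vecs X \<and> \<rho> (\<sigma> v) = v)"

lemma lin_iso_sym: "lin_iso X X' \<rho> \<sigma> \<Longrightarrow> lin_iso X' X \<sigma> \<rho>"
  by (auto simp: lin_iso_def)

lemma lin_isoI_bij:
  assumes "bij_betw \<rho> (vecs X) (vecs X')" "lin_on (vecs X) \<rho>"
  shows "lin_iso X X' \<rho> (inv_into (vecs X) \<rho>)"
proof -
  let ?\<sigma> = "inv_into (vecs X) \<rho>"
  have inv: "?\<sigma> v \<in> vecs X" "\<rho> (?\<sigma> v) = v" if "v \<in> vecs X'" for v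
    using assms(1) that inv_into_into[of v \<rho> "vecs X"] f_inv_into_f[of v \<rho> "vecs X"]
    by (auto simp: bij_betw_def)
  have inv': "\<rho> v \<in> vecs X'" "?\<sigma> (\<rho> v) = v" if "v \<in> vecs X" for v
    using assms(1) that by (auto simp: bij_betw_def)
  have "?\<sigma> (\<lambda>y. s * u y + t * v y) = (\<lambda>y. s * ?\<sigma> u y + t * ?\<sigma> v y)"
    if "u \<in> vecs X'" "v \<in> vecs X'" for u v s t
    using inv that inv'(2)[of "\<lambda>y. s * ?\<sigma> u y + t * ?\<sigma> v y"]
    by (simp add: lin_on_comb[OF assms(2)] subsp_comb[OF subsp_vecs])
  with inv inv' assms(2) show ?thesis by (simp add: lin_iso_def lin_on_def)
qed

text \<open>The matrix of the conjugate \<rho> M \<sigma>: its column at \<open>z\<close> is the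
  image of the standard basis vector at \<open>z\<close>, and it is set to zero outside
  \<open>X'\<close> so that it lies in \<open>mats X'\<close>.\<close>

definition transport ::
  "'a set \<Rightarrow> 'b set \<Rightarrow> (('a \<Rightarrow> complex) \<Rightarrow> 'b \<Rightarrow> complex) \<Rightarrow> (('b \<Rightarrow> complex) \<Rightarrow> 'a \<Rightarrow> complex)
    \<Rightarrow> ('a \<Rightarrow> 'a \<Rightarrow> complex) \<Rightarrow> ('b \<Rightarrow> 'b \<Rightarrow> complex)" where
  "transport X X' \<rho> \<sigma> M = (\<lambda>y z. if z \<in> X' then \<rho> (mvmult X M (\<sigma> (ind {z}))) y else 0)"

lemma
  assumes X': "finite X'" and iso: "lin_iso X X' \<rho> \<sigma>" and M: "M \<in> mats X"
  shows transport_mats: "transport X X' \<rho> \<sigma> M \<in> mats X'"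
    and mvmult_transport: "v \<in> vecs X' \<Longrightarrow> mvmult X' (transport X X' \<rho> \<sigma> M) v = \<rho> (mvmult X M (\<sigma> v))"
proof -
  have \<rho>: "lin_on (vecs X) \<rho>" "\<And>v. v \<in> vecs X \<Longrightarrow> \<rho> v \<in> vecs X'"
    and \<sigma>: "lin_on (vecs X') \<sigma>" "\<And>v. v \<in> vecs X' \<Longrightarrow> \<sigma> v \<in> vecs X"
    using iso by (auto simp: lin_iso_def)
  show "transport X X' \<rho> \<sigma> M \<in> mats X'"
    using \<rho>(2)[OF mvmult_vecs[OF M]] by (auto simp: mats_def transport_def vecs_def)
  assume v: "v \<in> vecs X'"
  have ind: "ind {z} \<in> vecs X'" if "z \<in> X'" for z using that by (intro ind_vecs) simp
  have "\<sigma> v = \<sigma> (\<lambda>y. \<Sum>z\<in>X'. v z * ind {z} y)" using ind_expand[OF X' v] by simp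
  also have "\<dots> = (\<lambda>y. \<Sum>z\<in>X'. v z * \<sigma> (ind {z}) y)"
    by (intro lin_on_sum[OF subsp_vecs \<sigma>(1)] ind)
  finally have "mvmult X M (\<sigma> v) = mvmult X M (\<lambda>y. \<Sum>z\<in>X'. v z * \<sigma> (ind {z}) y)" by simp
  also have "\<dots> = (\<lambda>y. \<Sum>z\<in>X'. v z * mvmult X M (\<sigma> (ind {z})) y)"
    by (intro lin_on_sum[OF subsp_vecs[of X] lin_on_mvmult] \<sigma> ind)
  finally have "\<rho> (mvmult X M (\<sigma> v)) = \<rho> (\<lambda>y. \<Sum>z\<in>X'. v z * mvmult X M (\<sigma> (ind {z})) y)" by simp
  also have "\<dots> = (\<lambda>y. \<Sum>z\<in>X'. v z * \<rho> (mvmult X M (\<sigma> (ind {z}))) y)"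
    by (intro lin_on_sum[OF subsp_vecs \<rho>(1)] mvmult_vecs M)
  finally show "mvmult X' (transport X X' \<rho> \<sigma> M) v = \<rho> (mvmult X M (\<sigma> v))"
    by (simp add: mvmult_def[of X'] transport_def mult.commute)
qed

lemma transport_cancel:
  assumes "finite X" "finite X'" "lin_iso X X' \<rho> \<sigma>" "M \<in> mats X"
  shows "transport X' X \<sigma> \<rho> (transport X X' \<rho> \<sigma> M) = M"
proof (rule mats_eqI[OF assms(1)])
  note iso' = lin_iso_sym[OF assms(3)]
  note T = transport_mats[OF assms(2-4)]
  show "transport X' X \<sigma> \<rho> (transport X X' \<rho> \<sigma> M) \<in> mats X"
    by (rule transport_mats[OF assms(1) iso' T])
  fix v assume "v \<in> vecs X"
  then show "mvmult X (transport X' X \<sigma> \<rho> (transport X X' \<rho> \<sigma> M)) v = mvmult X M v"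
    using assms(3) mvmult_vecs[OF assms(4)]
    by (simp add: mvmult_transport[OF assms(1) iso' T] mvmult_transport[OF assms(2-4)] lin_iso_def)
qed (use assms in auto)

text \<open>A matrix is determined by its action, so an intertwining relation identifies the
  conjugate of \<open>M\<close>. This is how the generators are carried over.\<close>

lemma transport_eqI:
  assumes "finite X'" "lin_iso X X' \<rho> \<sigma>" "M \<in> mats X" "M' \<in> mats X'"
    and "\<And>v. v \<in> vecs X \<Longrightarrow> \<rho> (mvmult X M v) = mvmult X' M' (\<rho> v)"
  shows "transport X X' \<rho> \<sigma> M = M'"
proof (rule mats_eqI[OF assms(1) transport_mats[OF assms(1-3)] assms(4)])
  fix v assume "v \<in> vecs X'"
  then show "mvmult X' (transport X X' \<rho> \<sigma> M) v = mvmult X' M' v"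
    using assms(2,5) by (simp add: mvmult_transport[OF assms(1-3)] lin_iso_def)
qed

lemma transport_add:
  assumes "finite X'" "lin_iso X X' \<rho> \<sigma>" "M \<in> mats X" "N \<in> mats X"
  shows "transport X X' \<rho> \<sigma> (\<lambda>y z. M y z + N y z)
    = (\<lambda>y z. transport X X' \<rho> \<sigma> M y z + transport X X' \<rho> \<sigma> N y z)"
proof -
  have "lin_on (vecs X) \<rho>" using assms(2) by (simp add: lin_iso_def)
  then show ?thesis
    by (simp add: transport_def fun_eq_iff mvmult_add lin_on_add mvmult_vecs[OF assms(3)]
        mvmult_vecs[OF assms(4)])
qed

lemma transport_smult:
  assumes "finite X'" "lin_iso X X' \<rho> \<sigma>" "M \<in> mats X"
  shows "transport X X' \<rho> \<sigma> (\<lambda>y z. s * M y z) = (\<lambda>y z. s * transport X X' \<rho> \<sigma> M y z)"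
proof -
  have "lin_on (vecs X) \<rho>" using assms(2) by (simp add: lin_iso_def)
  then show ?thesis
    by (simp add: transport_def fun_eq_iff mvmult_smult lin_on_smult mvmult_vecs[OF assms(3)])
qed

lemma transport_mmult:
  assumes "finite X'" "lin_iso X X' \<rho> \<sigma>" "M \<in> mats X" "N \<in> mats X"
  shows "transport X X' \<rho> \<sigma> (mmult X M N)
    = mmult X' (transport X X' \<rho> \<sigma> M) (transport X X' \<rho> \<sigma> N)"
proof (rule transport_eqI[OF assms(1,2) mats_closed(3)[OF assms(3,4)]
      mats_closed(3)[OF transport_mats transport_mats, OF assms(1-3) assms(1,2,4)]])
  fix v assume v: "v \<in> vecs X"
  note mv = mvmult_vecs[OF assms(4)]
  have "\<rho> v \<in> vecs X'" "\<rho> (mvmult X N v) \<in> vecs X'" "\<sigma> (\<rho> v) = v"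
    "\<sigma> (\<rho> (mvmult X N v)) = mvmult X N v"
    using assms(2) v mv by (auto simp: lin_iso_def)
  then show "\<rho> (mvmult X (mmult X M N) v) =
      mvmult X' (mmult X' (transport X X' \<rho> \<sigma> M) (transport X X' \<rho> \<sigma> N)) (\<rho> v)"
    by (simp add: mvmult_mmult mvmult_transport[OF assms(1-3)] mvmult_transport[OF assms(1,2,4)])
qed

text \<open>Conjugation respects sums, scalar multiples and products, so membership has to be
  checked on the generators only, where it is the assumed intertwining.\<close>

lemma transport_T_alg:
  assumes X': "finite X'" and iso: "lin_iso X X' \<rho> \<sigma>" and D: "diameter X E = diameter X' E'"
    and A: "\<And>v. v \<in> vecs X \<Longrightarrow> \<rho> (mvmult X (adj_mat X E) v) = mvmult X' (adj_mat X' E') (\<rho> v)"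
    and E: "\<And>i v. i \<le> diameter X E \<Longrightarrow> v \<in> vecs X \<Longrightarrow>
      \<rho> (mvmult X (dual_idem X E x i) v) = mvmult X' (dual_idem X' E' x' i) (\<rho> v)"
    and M: "M \<in> T_alg X E x"
  shows "transport X X' \<rho> \<sigma> M \<in> T_alg X' E' x'"
  using M
proof induction
  case gen_A
  then show ?case
    by (subst transport_eqI[OF X' iso adj_mat_mats adj_mat_mats[of X' E'] A]) (auto intro: T_alg.gen_A)
next
  case (gen_E i)
  then show ?case using D
    by (subst transport_eqI[OF X' iso dual_idem_mats dual_idem_mats[of X' E' x' i] E])
      (auto intro: T_alg.gen_E)
next
  case (add M N)
  then show ?case
    by (subst transport_add[OF X' iso]) (auto intro: T_alg.add T_alg_mats)
next
  case (smult M s)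
  then show ?case
    by (subst transport_smult[OF X' iso]) (auto intro: T_alg.smult T_alg_mats)
next
  case (mult M N)
  then show ?case
    by (subst transport_mmult[OF X' iso]) (auto intro: T_alg.mult T_alg_mats)
qed

text \<open>The algebra isomorphism is conjugation by \<rho>, with conjugation by \<sigma> as its
  inverse; its algebraic laws and its compatibility with \<rho> come from those of
  conjugation.\<close>

lemma T_isomorphicI:
  assumes fin: "finite X" "finite X'" and D: "diameter X E = diameter X' E'"
    and card: "card X = card X'"
    and ex: "\<And>x x'. x \<in> X \<Longrightarrow> x' \<in> X' \<Longrightarrow> \<exists>\<rho> \<sigma>. lin_iso X X' \<rho> \<sigma>
      \<and> (\<forall>v\<in>vecs X. \<rho> (mvmult X (adj_mat X E) v) = mvmult X' (adj_mat X' E') (\<rho> v))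
      \<and> (\<forall>i\<le>diameter X E. \<forall>v\<in>vecs X.
            \<rho> (mvmult X (dual_idem X E x i) v) = mvmult X' (dual_idem X' E' x' i) (\<rho> v))"
  shows "T_isomorphic X E X' E'"
  unfolding T_isomorphic_def
proof (intro conjI ballI D card)
  fix x x' assume "x \<in> X" "x' \<in> X'"
  from ex[OF this] obtain \<rho> \<sigma> where iso: "lin_iso X X' \<rho> \<sigma>"
    and A: "\<And>v. v \<in> vecs X \<Longrightarrow> \<rho> (mvmult X (adj_mat X E) v) = mvmult X' (adj_mat X' E') (\<rho> v)"
    and E: "\<And>i v. i \<le> diameter X E \<Longrightarrow> v \<in> vecs X \<Longrightarrow>
      \<rho> (mvmult X (dual_idem X E x i) v) = mvmult X' (dual_idem X' E' x' i) (\<rho> v)"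
    by blast
  note iso' = lin_iso_sym[OF iso]
  have \<rho>: "lin_on (vecs X) \<rho>" "\<And>v. v \<in> vecs X \<Longrightarrow> \<rho> v \<in> vecs X'" "\<And>v. v \<in> vecs X \<Longrightarrow> \<sigma> (\<rho> v) = v"
    and \<sigma>: "\<And>v. v \<in> vecs X' \<Longrightarrow> \<sigma> v \<in> vecs X" "\<And>v. v \<in> vecs X' \<Longrightarrow> \<rho> (\<sigma> v) = v"
    using iso by (auto simp: lin_iso_def)
  \<comment> \<open>An intertwining relation for \<rho> turns into one for its inverse \<sigma>, so
    that \<open>transport_T_alg\<close> also applies in the opposite direction.\<close>
  have flip: "\<sigma> (mvmult X' M' v) = mvmult X M (\<sigma> v)"
    if "\<And>v. v \<in> vecs X \<Longrightarrow> \<rho> (mvmult X M v) = mvmult X' M' (\<rho> v)" "v \<in> vecs X'" "M \<in> mats X" for M M' v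
    using that(1)[OF \<sigma>(1)[OF that(2)]] \<rho>(3)[OF mvmult_vecs[OF that(3)]] \<sigma>(2)[OF that(2)] by metis
  let ?f = "transport X X' \<rho> \<sigma>"
  let ?g = "transport X' X \<sigma> \<rho>"
  note fT = transport_T_alg[OF fin(2) iso D A E]
  have gT: "?g M \<in> T_alg X E x" if "M \<in> T_alg X' E' x'" for M
    using D that
    by (intro transport_T_alg[OF fin(1) iso', of E' E x' x])
      (auto intro!: flip A E adj_mat_mats dual_idem_mats)
  have bij: "bij_betw ?f (T_alg X E x) (T_alg X' E' x')"
    using transport_cancel[OF fin iso T_alg_mats] transport_cancel[OF fin(2,1) iso' T_alg_mats] fT gT
    by (intro bij_betw_byWitness[where f' = ?g]) auto
  have "bij_betw \<rho> (vecs X) (vecs X')"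
    using \<rho> \<sigma> by (intro bij_betw_byWitness[where f' = \<sigma>]) auto
  moreover have "\<forall>B\<in>T_alg X E x. \<forall>v\<in>vecs X. \<rho> (mvmult X B v) = mvmult X' (?f B) (\<rho> v)"
    using \<rho> by (auto simp: mvmult_transport[OF fin(2) iso T_alg_mats])
  ultimately have \<rho>_props: "\<exists>\<rho>. bij_betw \<rho> (vecs X) (vecs X')
      \<and> (\<forall>u\<in>vecs X. \<forall>v\<in>vecs X. \<rho> (\<lambda>y. u y + v y) = (\<lambda>y. \<rho> u y + \<rho> v y))
      \<and> (\<forall>s. \<forall>v\<in>vecs X. \<rho> (\<lambda>y. s * v y) = (\<lambda>y. s * \<rho> v y))
      \<and> (\<forall>B\<in>T_alg X E x. \<forall>v\<in>vecs X. \<rho> (mvmult X B v) = mvmult X' (?f B) (\<rho> v))"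
    using lin_on_add[OF \<rho>(1)] lin_on_smult[OF \<rho>(1)] by (intro exI[of _ \<rho>]) auto
  show "\<exists>f. bij_betw f (T_alg X E x) (T_alg X' E' x')
        \<and> (\<forall>M\<in>T_alg X E x. \<forall>N\<in>T_alg X E x. f (\<lambda>y z. M y z + N y z) = (\<lambda>y z. f M y z + f N y z))
        \<and> (\<forall>s. \<forall>M\<in>T_alg X E x. f (\<lambda>y z. s * M y z) = (\<lambda>y z. s * f M y z))
        \<and> (\<forall>M\<in>T_alg X E x. \<forall>N\<in>T_alg X E x. f (mmult X M N) = mmult X' (f M) (f N))
        \<and> f (adj_mat X E) = adj_mat X' E'
        \<and> (\<forall>i\<le>diameter X E. f (dual_idem X E x i) = dual_idem X' E' x' i)
        \<and> (\<exists>\<rho>. bij_betw \<rho> (vecs X) (vecs X')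
            \<and> (\<forall>u\<in>vecs X. \<forall>v\<in>vecs X. \<rho> (\<lambda>y. u y + v y) = (\<lambda>y. \<rho> u y + \<rho> v y))
            \<and> (\<forall>s. \<forall>v\<in>vecs X. \<rho> (\<lambda>y. s * v y) = (\<lambda>y. s * \<rho> v y))
            \<and> (\<forall>B\<in>T_alg X E x. \<forall>v\<in>vecs X. \<rho> (mvmult X B v) = mvmult X' (f B) (\<rho> v)))"
    by (rule exI[of _ ?f]) (intro conjI bij \<rho>_props ballI allI impI transport_add[OF fin(2) iso]
        transport_smult[OF fin(2) iso] transport_mmult[OF fin(2) iso] T_alg_mats
        transport_eqI[OF fin(2) iso] adj_mat_mats dual_idem_mats A E; assumption)
qed

text \<open>The two bases need not have equal norms: the map is only required to be a linear bijection.\<close>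
definition basis_map ::
  "'a set \<Rightarrow> 'i set \<Rightarrow> ('i \<Rightarrow> 'a \<Rightarrow> complex) \<Rightarrow> ('i \<Rightarrow> 'b \<Rightarrow> complex) \<Rightarrow> ('a \<Rightarrow> complex) \<Rightarrow> 'b \<Rightarrow> complex" where
  "basis_map X I b b' v = (\<lambda>y. \<Sum>i\<in>I. (ip X (b i) v / ip X (b i) (b i)) * b' i y)"

lemma lin_on_basis_map: "lin_on S (basis_map X I b b')"
  by (simp add: lin_on_def basis_map_def ip_comb_right add_divide_distrib sum.distrib
      sum_distrib_left algebra_simps)

lemma basis_map_basis:
  assumes "finite X" "orth_basis X S I b" "S \<subseteq> vecs X" "i \<in> I"
  shows "basis_map X I b b' (b i) = b' i"
proof
  fix y
  have "basis_map X I b b' (b i) y = (\<Sum>j\<in>I. if j = i then b' i y else 0)"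
    unfolding basis_map_def using assms orth_basis_coeff[OF assms]
    by (intro sum.cong) (auto simp: orth_basis_def)
  with assms show "basis_map X I b b' (b i) y = b' i y" by (simp add: orth_basis_def)
qed

lemma basis_map_inverse:
  assumes "finite X" "finite X'" and b: "orth_basis X (vecs X) I b" and b': "orth_basis X' (vecs X') I b'"
    and v: "v \<in> vecs X"
  shows "basis_map X I b b' v \<in> vecs X'" "basis_map X' I b' b (basis_map X I b b' v) = v"
proof -
  show "basis_map X I b b' v \<in> vecs X'"
    unfolding basis_map_def using b' by (intro subsp_sum subsp_vecs) (auto simp: orth_basis_def)
  have "basis_map X' I b' b (basis_map X I b b' v)
      = (\<lambda>y. \<Sum>i\<in>I. (ip X (b i) v / ip X (b i) (b i)) * b i y)"
    unfolding basis_map_def[of X'] basis_map_def[of X]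
    by (intro ext sum.cong refl, subst orth_basis_ip_sum[OF assms(2) b' subset_refl])
      (simp_all add: orth_basis_coeff[OF assms(2) b' subset_refl])
  then show "basis_map X' I b' b (basis_map X I b b' v) = v"
    using orth_basis_expand[OF assms(1) b subsp_vecs subset_refl v] by simp
qed

lemma basis_map_lin_iso:
  assumes "finite X" "finite X'" "orth_basis X (vecs X) I b" "orth_basis X' (vecs X') I b'"
  shows "lin_iso X X' (basis_map X I b b') (basis_map X' I b' b)"
  unfolding lin_iso_def
  by (intro conjI ballI lin_on_basis_map basis_map_inverse assms)

lemma lin_intertwineI:
  assumes X: "finite X" and b: "orth_basis X (vecs X) I b" and \<rho>: "lin_on (vecs X) \<rho>"
    and M: "M \<in> mats X" and eq: "\<And>i. i \<in> I \<Longrightarrow> \<rho> (mvmult X M (b i)) = mvmult X' M' (\<rho> (b i))"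
    and \<rho>_vecs: "\<And>v. v \<in> vecs X \<Longrightarrow> \<rho> v \<in> vecs X'" and v: "v \<in> vecs X"
  shows "\<rho> (mvmult X M v) = mvmult X' M' (\<rho> v)"
proof -
  let ?r = "\<lambda>i. ip X (b i) v / ip X (b i) (b i)"
  have bS: "b i \<in> vecs X" if "i \<in> I" for i using b that by (simp add: orth_basis_def)
  have v': "v = (\<lambda>y. \<Sum>i\<in>I. ?r i * b i y)"
    by (rule orth_basis_expand[OF X b subsp_vecs subset_refl v])
  have "\<rho> (mvmult X M (\<lambda>y. \<Sum>i\<in>I. ?r i * b i y)) = \<rho> (\<lambda>y. \<Sum>i\<in>I. ?r i * mvmult X M (b i) y)"
    by (intro arg_cong[of _ _ \<rho>] lin_on_sum[OF subsp_vecs[of X] lin_on_mvmult] bS)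
  also have "\<dots> = (\<lambda>y. \<Sum>i\<in>I. ?r i * \<rho> (mvmult X M (b i)) y)"
    by (intro lin_on_sum[OF subsp_vecs \<rho>] mvmult_vecs M)
  also have "\<dots> = (\<lambda>y. \<Sum>i\<in>I. ?r i * mvmult X' M' (\<rho> (b i)) y)"
    by (simp add: eq)
  also have "\<dots> = mvmult X' M' (\<lambda>y. \<Sum>i\<in>I. ?r i * \<rho> (b i) y)"
    by (intro lin_on_sum[OF subsp_vecs[of X'] lin_on_mvmult, symmetric] \<rho>_vecs bS)
  also have "(\<lambda>y. \<Sum>i\<in>I. ?r i * \<rho> (b i) y) = \<rho> (\<lambda>y. \<Sum>i\<in>I. ?r i * b i y)"
    by (intro lin_on_sum[OF subsp_vecs \<rho>, symmetric] bS)
  finally show ?thesis by (simp only: v'[symmetric])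
qed

section \<open>Characteristic polynomials of matrices indexed by a finite set\<close>

definition mat_on :: "'a list \<Rightarrow> ('a \<Rightarrow> 'a \<Rightarrow> complex) \<Rightarrow> complex mat" where
  "mat_on vs M = mat (length vs) (length vs) (\<lambda>(i, j). M (vs ! i) (vs ! j))"

lemma sum_nth_distinct:
  assumes "distinct vs" "set vs = Y"
  shows "(\<Sum>i = 0..<length vs. g (vs ! i)) = (\<Sum>y\<in>Y. g y)"
proof -
  have "inj_on ((!) vs) {0..<length vs}" "Y = (!) vs ` {0..<length vs}"
    using assms inj_on_nth[OF assms(1), of "{0..<length vs}"] by (auto simp: set_conv_nth)
  then show ?thesis by (simp add: sum.reindex)
qed

lemma char_poly_eqI:
  assumes "A \<in> carrier_mat m m" "B \<in> carrier_mat m m" "P \<in> carrier_mat m m" "Q \<in> carrier_mat m m"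
    and "Q * P = 1\<^sub>m m" "(A :: complex mat) * P = P * B"
  shows "char_poly A = char_poly B"
proof (rule char_poly_similar)
  have PQ: "P * Q = 1\<^sub>m m" by (rule mat_mult_left_right_inverse[OF assms(4,3,5)])
  have "A = A * (P * Q)" using assms PQ by simp
  also have "\<dots> = P * B * Q" using assms by (simp flip: assoc_mult_mat[of A m m P m Q m])
  finally show "similar_mat A B"
    using assms PQ by (intro similar_matI[of _ _ P Q m]) auto
qed

text \<open>In coordinates \<rho> becomes an invertible matrix \<open>P\<close> conjugating the two
  matrices. The hypothesis cuts back to \<open>Y\<close> and \<open>Y'\<close> because
  \<open>M\<close> and \<open>M'\<close> may have nonzero rows outside these sets, as the full
  adjacency matrices have when \<open>Y\<close> is a neighbourhood.\<close>

lemma char_poly_lin_iso: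
  assumes vs: "distinct vs" "set vs = Y" and vs': "distinct vs'" "set vs' = Y'"
    and card: "card Y = card Y'" and iso: "lin_iso Y Y' \<rho> \<sigma>"
    and eq: "\<And>v. v \<in> vecs Y \<Longrightarrow> \<rho> (\<lambda>y. if y \<in> Y then mvmult Y M v y else 0)
      = (\<lambda>y. if y \<in> Y' then mvmult Y' M' (\<rho> v) y else 0)"
  shows "char_poly (mat_on vs M) = char_poly (mat_on vs' M')"
proof -
  let ?m = "length vs"
  have m': "length vs' = ?m" using card vs vs' distinct_card by metis
  define P where "P = mat ?m ?m (\<lambda>(i, j). \<rho> (ind {vs ! j}) (vs' ! i))"
  define Q where "Q = mat ?m ?m (\<lambda>(i, j). \<sigma> (ind {vs' ! j}) (vs ! i))"
  have fin: "finite Y" "finite Y'" using vs vs' by auto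
  have ind: "ind {y} \<in> vecs Y" if "y \<in> Y" for y using that by (intro ind_vecs) auto
  have ind': "ind {y} \<in> vecs Y'" if "y \<in> Y'" for y using that by (intro ind_vecs) auto
  have \<rho>: "lin_on (vecs Y) \<rho>" "\<And>v. v \<in> vecs Y \<Longrightarrow> \<rho> v \<in> vecs Y'" "\<And>v. v \<in> vecs Y \<Longrightarrow> \<sigma> (\<rho> v) = v"
    and \<sigma>: "lin_on (vecs Y') \<sigma>" "\<And>v. v \<in> vecs Y' \<Longrightarrow> \<sigma> v \<in> vecs Y" "\<And>v. v \<in> vecs Y' \<Longrightarrow> \<rho> (\<sigma> v) = v"
    using iso by (auto simp: lin_iso_def)
  have nth: "vs ! i \<in> Y" "vs' ! i \<in> Y'" if "i < ?m" for i using vs vs' m' that by auto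
  have \<sigma>_sum: "(\<Sum>z\<in>Y'. \<sigma> (ind {z}) y * v z) = \<sigma> v y" if "v \<in> vecs Y'" for v y
    using ind_expand[OF fin(2) that] lin_on_sum[OF subsp_vecs \<sigma>(1), of Y' "\<lambda>z. ind {z}" v] ind'
    by (simp add: mult.commute)
  have \<rho>_sum: "(\<Sum>z\<in>Y. \<rho> (ind {z}) y * v z) = \<rho> v y" if "v \<in> vecs Y" for v y
    using ind_expand[OF fin(1) that] lin_on_sum[OF subsp_vecs \<rho>(1), of Y "\<lambda>z. ind {z}" v] ind
    by (simp add: mult.commute)
  have "Q * P = 1\<^sub>m ?m"
  proof (rule eq_matI)
    fix i j assume "i < dim_row (1\<^sub>m ?m :: complex mat)" "j < dim_col (1\<^sub>m ?m :: complex mat)"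
    then have ij: "i < ?m" "j < ?m" by auto
    have "(Q * P) $$ (i, j) = (\<Sum>l = 0..<length vs'. \<sigma> (ind {vs' ! l}) (vs ! i) * \<rho> (ind {vs ! j}) (vs' ! l))"
      using ij m' by (simp add: P_def Q_def scalar_prod_def)
    also have "\<dots> = ind {vs ! j} (vs ! i)"
      using ij nth by (simp add: sum_nth_distinct[OF vs', of "\<lambda>y. \<sigma> (ind {y}) _ * \<rho> _ y"] \<sigma>_sum \<rho> ind)
    also have "\<dots> = 1\<^sub>m ?m $$ (i, j)" using ij vs(1) by (simp add: ind_def nth_eq_iff_index_eq)
    finally show "(Q * P) $$ (i, j) = 1\<^sub>m ?m $$ (i, j)" .
  qed (auto simp: P_def Q_def)
  moreover have "mat_on vs' M' * P = P * mat_on vs M"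
  proof (rule eq_matI)
    fix i j assume "i < dim_row (P * mat_on vs M)" "j < dim_col (P * mat_on vs M)"
    then have ij: "i < ?m" "j < ?m" by (auto simp: P_def mat_on_def)
    have "(mat_on vs' M' * P) $$ (i, j)
        = (\<Sum>l = 0..<length vs'. M' (vs' ! i) (vs' ! l) * \<rho> (ind {vs ! j}) (vs' ! l))"
      using ij m' by (simp add: P_def mat_on_def scalar_prod_def)
    also have "\<dots> = mvmult Y' M' (\<rho> (ind {vs ! j})) (vs' ! i)"
      by (simp add: sum_nth_distinct[OF vs', of "\<lambda>y. M' _ y * \<rho> _ y"] mvmult_def)
    also have "\<dots> = \<rho> (\<lambda>y. if y \<in> Y then mvmult Y M (ind {vs ! j}) y else 0) (vs' ! i)"
      using ij nth by (subst eq) (auto intro: ind)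
    also have "\<dots> = (\<Sum>z\<in>Y. \<rho> (ind {z}) (vs' ! i) * (if z \<in> Y then mvmult Y M (ind {vs ! j}) z else 0))"
      by (intro \<rho>_sum[symmetric]) (simp add: vecs_def)
    also have "\<dots> = (\<Sum>z\<in>Y. \<rho> (ind {z}) (vs' ! i) * M z (vs ! j))"
      using ij nth fin by (intro sum.cong refl) (simp add: mvmult_ind_single)
    also have "\<dots> = (\<Sum>l = 0..<length vs. \<rho> (ind {vs ! l}) (vs' ! i) * M (vs ! l) (vs ! j))"
      by (simp add: sum_nth_distinct[OF vs, of "\<lambda>z. \<rho> (ind {z}) _ * M z _"])
    also have "\<dots> = (P * mat_on vs M) $$ (i, j)"
      using ij by (simp add: P_def mat_on_def scalar_prod_def)
    finally show "(mat_on vs' M' * P) $$ (i, j) = (P * mat_on vs M) $$ (i, j)" .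
  qed (auto simp: P_def mat_on_def m')
  ultimately show ?thesis
    by (intro char_poly_eqI[of _ ?m _ P Q, symmetric]) (auto simp: mat_on_def P_def Q_def m')
qed

lemma proots_prod_linear_factors:
  fixes xs :: "'a :: idom list"
  shows "proots (\<Prod>a\<leftarrow>xs. [:- a, 1:]) = mset xs"
proof (induction xs)
  case (Cons x xs)
  have "(\<Prod>a\<leftarrow>xs. [:- a, 1:]) \<noteq> 0" by (auto simp: prod_list_zero_iff)
  moreover have "[:- x, 1:] \<noteq> 0" by simp
  ultimately have "proots ([:- x, 1:] * (\<Prod>a\<leftarrow>xs. [:- a, 1:])) = {#x#} + mset xs"
    using Cons by (subst proots_mult) (simp_all del: mult_pCons_left)
  then show ?case by (simp del: mult_pCons_left)
qed simp

text \<open>The eigenvectors are the columns of \<open>P\<close>. By orthogonality its inverse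
  \<open>Q\<close> is the conjugate transpose with each row divided by a squared norm, so the matrix
  is similar to the diagonal matrix of the \<open>ev i\<close>.\<close>

lemma proots_char_poly_orth_basis:
  assumes vs: "distinct vs" "set vs = Y" and b: "orth_basis Y (vecs Y) I b"
    and ev: "\<And>i y. i \<in> I \<Longrightarrow> y \<in> Y \<Longrightarrow> mvmult Y M (b i) y = ev i * b i y"
  shows "proots (char_poly (mat_on vs M)) = image_mset ev (mset_set I)"
proof -
  let ?m = "length vs"
  have Y: "finite Y" and I: "finite I" using vs b by (auto simp: orth_basis_def)
  obtain js where js: "distinct js" "set js = I" using finite_distinct_list[OF I] by blast
  have m: "length js = ?m" using orth_basis_card[OF Y b] vs js distinct_card by metis
  define P where "P = mat ?m ?m (\<lambda>(i, j). b (js ! j) (vs ! i))"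
  define Q where "Q = mat ?m ?m (\<lambda>(i, j). cnj (b (js ! i) (vs ! j)) / ip Y (b (js ! i)) (b (js ! i)))"
  define D where "D = mat ?m ?m (\<lambda>(i, j). if i = j then ev (js ! i) else 0)"
  have nth: "vs ! i \<in> Y" "js ! i \<in> I" if "i < ?m" for i using vs js m that by auto
  have "Q * P = 1\<^sub>m ?m"
  proof (rule eq_matI)
    fix i j assume "i < dim_row (1\<^sub>m ?m :: complex mat)" "j < dim_col (1\<^sub>m ?m :: complex mat)"
    then have ij: "i < ?m" "j < ?m" by auto
    let ?c = "ip Y (b (js ! i)) (b (js ! i))"
    have "(Q * P) $$ (i, j) = (\<Sum>l = 0..<?m. cnj (b (js ! i) (vs ! l)) / ?c * b (js ! j) (vs ! l))"
      using ij by (simp add: P_def Q_def scalar_prod_def)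
    also have "\<dots> = ip Y (b (js ! i)) (b (js ! j)) / ?c"
      by (simp add: sum_nth_distinct[OF vs, of "\<lambda>y. cnj (b (js ! i) y) * b (js ! j) y / ?c"]
        ip_def[of Y _ "b (js ! j)"] sum_divide_distrib)
    also have "\<dots> = 1\<^sub>m ?m $$ (i, j)"
      using ij nth b js m orth_basis_coeff[OF Y b subset_refl, of "js ! i"]
      by (cases "i = j") (auto simp: orth_basis_def nth_eq_iff_index_eq)
    finally show "(Q * P) $$ (i, j) = 1\<^sub>m ?m $$ (i, j)" .
  qed (auto simp: P_def Q_def)
  moreover have "mat_on vs M * P = P * D"
  proof (rule eq_matI)
    fix i j assume "i < dim_row (P * D)" "j < dim_col (P * D)"
    then have ij: "i < ?m" "j < ?m" by (auto simp: P_def D_def)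
    have mult_if: "x * (if P then y else 0) = (if P then x * y else 0)" for P and x y :: complex
      by simp
    have "(mat_on vs M * P) $$ (i, j) = (\<Sum>l = 0..<?m. M (vs ! i) (vs ! l) * b (js ! j) (vs ! l))"
      using ij by (simp add: P_def mat_on_def scalar_prod_def)
    also have "\<dots> = mvmult Y M (b (js ! j)) (vs ! i)"
      by (simp add: sum_nth_distinct[OF vs, of "\<lambda>y. M _ y * b _ y"] mvmult_def)
    also have "\<dots> = (\<Sum>l = 0..<?m. if l = j then b (js ! j) (vs ! i) * ev (js ! j) else 0)"
      using ij nth by (simp add: ev)
    also have "\<dots> = (P * D) $$ (i, j)"
      using ij by (simp add: P_def D_def scalar_prod_def mult_if cong: if_cong)
    finally show "(mat_on vs M * P) $$ (i, j) = (P * D) $$ (i, j)" .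
  qed (auto simp: P_def D_def mat_on_def)
  ultimately have "char_poly (mat_on vs M) = char_poly D"
    by (intro char_poly_eqI[of _ ?m _ P Q]) (auto simp: mat_on_def P_def Q_def D_def)
  also have "\<dots> = (\<Prod>a \<leftarrow> diag_mat D. [:- a, 1:])"
    by (rule char_poly_upper_triangular[of _ ?m]) (auto simp: D_def)
  also have "diag_mat D = map ev js"
    by (auto simp: diag_mat_def D_def m intro!: nth_equalityI)
  also have "proots (\<Prod>a \<leftarrow> map ev js. [:- a, 1:]) = mset (map ev js)"
    by (rule proots_prod_linear_factors)
  also have "\<dots> = image_mset ev (mset_set I)"
    using js by (metis mset_map mset_set_set)
  finally show ?thesis .
qed

section \<open>Matching equal multisets of eigenvalues\<close>

text \<open>Converts equality of spectra with multiplicities into a bijection between eigenbases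
  that preserves eigenvalues; elements with a common value are matched off one at a time.\<close>

lemma bij_betw_of_image_mset_eq:
  assumes "finite U" "finite V" "image_mset f (mset_set U) = image_mset g (mset_set V)"
  shows "\<exists>h. bij_betw h U V \<and> (\<forall>u\<in>U. g (h u) = f u)"
  using assms
proof (induction U arbitrary: V rule: finite_induct)
  case empty
  then show ?case by (auto simp: mset_set_empty_iff bij_betw_def dest: sym)
next
  case (insert u U)
  then have "f u \<in># image_mset g (mset_set V)" by (metis image_mset_add_mset mset_set.insert union_single_eq_member)
  then obtain v where v: "v \<in> V" "g v = f u" using insert.prems(1) by auto
  then have "mset_set V = add_mset v (mset_set (V - {v}))"
    using insert.prems(1) by (simp add: mset_set.remove)
  with insert v have "image_mset f (mset_set U) = image_mset g (mset_set (V - {v}))" by simp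
  with insert.IH[of "V - {v}"] insert.prems obtain h where
    h: "bij_betw h U (V - {v})" "\<forall>u\<in>U. g (h u) = f u" by auto
  have "bij_betw (h(u := v)) (insert u U) (insert v (V - {v}))"
    using h(1) insert.hyps by (auto simp: bij_betw_def inj_on_def)
  then have "bij_betw (h(u := v)) (insert u U) V" using v(1) by (simp only: insert_Diff)
  moreover have "\<forall>w\<in>insert u U. g ((h(u := v)) w) = f w" using h v insert.hyps by auto
  ultimately show ?case by blast
qed

text \<open>If \<open>r\<close> is taken m times, the sum is m (r - s) + card U * s. For distinct
  \<open>r\<close> and \<open>s\<close> the cardinality and the sum therefore determine m; for
  \<open>r = s\<close> the cardinality suffices.\<close>

lemma image_mset_eq_two_values:
  fixes f :: "'u \<Rightarrow> complex" and g :: "'v \<Rightarrow> complex"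
  assumes "finite U" "finite V" "card U = card V" "sum f U = sum g V"
    and f: "\<And>u. u \<in> U \<Longrightarrow> f u = r \<or> f u = s" and g: "\<And>v. v \<in> V \<Longrightarrow> g v = r \<or> g v = s"
  shows "image_mset f (mset_set U) = image_mset g (mset_set V)"
proof -
  have im: "image_mset h (mset_set W) = replicate_mset (card {w\<in>W. h w = r}) r
        + replicate_mset (card W - card {w\<in>W. h w = r}) s"
    and sum: "sum h W = of_nat (card {w\<in>W. h w = r}) * (r - s) + of_nat (card W) * s"
    and le: "card {w\<in>W. h w = r} \<le> card W"
    if "finite W" "\<And>w. w \<in> W \<Longrightarrow> h w = r \<or> h w = s" for h :: "'w \<Rightarrow> complex" and W
  proof -
    show le: "card {w\<in>W. h w = r} \<le> card W" using that(1) by (intro card_mono) auto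
    have W: "W = {w\<in>W. h w = r} \<union> {w\<in>W. h w \<noteq> r}" by auto
    have c: "card {w\<in>W. h w \<noteq> r} = card W - card {w\<in>W. h w = r}"
      by (subst card_Diff_subset[symmetric]) (use that(1) in \<open>auto intro!: arg_cong[of _ _ card]\<close>)
    have "image_mset h (mset_set W) = image_mset h (mset_set {w\<in>W. h w = r})
        + image_mset h (mset_set {w\<in>W. h w \<noteq> r})"
      by (subst W, subst mset_set_Union) (use that(1) in auto)
    also have "image_mset h (mset_set {w\<in>W. h w = r}) = image_mset (\<lambda>_. r) (mset_set {w\<in>W. h w = r})"
      using that(1) by (intro image_mset_cong) auto
    also have "image_mset h (mset_set {w\<in>W. h w \<noteq> r}) = image_mset (\<lambda>_. s) (mset_set {w\<in>W. h w \<noteq> r})"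
      using that by (intro image_mset_cong) auto
    finally show "image_mset h (mset_set W) = replicate_mset (card {w\<in>W. h w = r}) r
        + replicate_mset (card W - card {w\<in>W. h w = r}) s"
      by (simp add: image_mset_const_eq c)
    have "sum h W = (\<Sum>w\<in>W. (if h w = r then r - s else 0) + s)"
      using that by (intro sum.cong) auto
    also have "\<dots> = of_nat (card {w\<in>W. h w = r}) * (r - s) + of_nat (card W) * s"
      unfolding sum.distrib using that(1) by (simp add: sum.If_cases Int_def)
    finally show "sum h W = of_nat (card {w\<in>W. h w = r}) * (r - s) + of_nat (card W) * s" .
  qed
  show ?thesis
  proof (cases "r = s")
    case True
    with im[OF assms(1) f] im[OF assms(2) g] assms(3) le[OF assms(1) f] le[OF assms(2) g]
    show ?thesis by (simp add: multiset_eq_iff)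
  next
    case False
    with sum[OF assms(1) f] sum[OF assms(2) g] assms(3,4)
    have "(of_nat (card {u\<in>U. f u = r}) :: complex) = of_nat (card {v\<in>V. g v = r})" by simp
    then have "card {u\<in>U. f u = r} = card {v\<in>V. g v = r}" by (simp only: of_nat_eq_iff)
    then show ?thesis using im[OF assms(1) f] im[OF assms(2) g] assms(3) by simp
  qed
qed

section \<open>Strongly regular graphs seen from a vertex\<close>

text \<open>On vectors this is multiplication by the diagonal 0-1 matrix of \<open>Y\<close>; for a
  sphere around \<open>x\<close> it is the action of the corresponding
  \<open>dual_idem\<close>.\<close>

definition cut :: "'a set \<Rightarrow> ('a \<Rightarrow> complex) \<Rightarrow> 'a \<Rightarrow> complex" where
  "cut Y v = (\<lambda>y. if y \<in> Y then v y else 0)"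

lemma cut_vecs: "cut Y v \<in> vecs Y"
  by (simp add: cut_def vecs_def)

lemma vecs_mono: "v \<in> vecs Y \<Longrightarrow> Y \<subseteq> X \<Longrightarrow> v \<in> vecs X"
  by (auto simp: vecs_def)

lemma cut_same: "v \<in> vecs Y \<Longrightarrow> cut Y v = v"
  by (auto simp: cut_def vecs_def)

lemma cut_disjoint: "v \<in> vecs Z \<Longrightarrow> Y \<inter> Z = {} \<Longrightarrow> cut Y v = (\<lambda>_. 0)"
  by (auto simp: cut_def vecs_def fun_eq_iff)

lemma lin_on_cut: "lin_on S (cut Y)"
  by (auto simp: lin_on_def cut_def)

lemma ip_cut_right: "u \<in> vecs Y \<Longrightarrow> ip X u (cut Y v) = ip X u v"
  unfolding ip_def by (intro sum.cong) (auto simp: cut_def vecs_def)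

lemma ip_cut_left: "u \<in> vecs Y \<Longrightarrow> ip X (cut Y v) u = ip X v u"
  unfolding ip_def by (intro sum.cong) (auto simp: cut_def vecs_def)

section \<open>Index set and structure constants of the adapted basis\<close>

text \<open>Labels for a basis of the whole space, free of any reference to a graph:
  \<open>X0\<close>, \<open>X1\<close>, \<open>X2\<close> for the sphere indicators,
  \<open>IU\<close> for local eigenvectors, \<open>IW\<close> for their projections to the second
  sphere, \<open>IZ\<close> for the remaining eigenvectors of \<open>A\<close>. The function
  \<open>lev\<close> records which sphere supports the vector.\<close>

datatype ('l, 'q) idx = X0 | X1 | X2 | IU 'l | IW 'l | IZ 'q

primrec lev :: "('l, 'q) idx \<Rightarrow> nat" where
  "lev X0 = 0" | "lev X1 = 1" | "lev X2 = 2" | "lev (IU j) = 1" | "lev (IW j) = 2" | "lev (IZ q) = 2"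

text \<open>The negative of t^2 - (a - c) t - (k - c) at t = \<open>l\<close>. It arises as the
  coefficient of \<open>u j\<close> in \<open>A (W j)\<close> when \<open>l\<close> is the local
  eigenvalue of \<open>u j\<close>.\<close>

definition srg_mu :: "nat \<Rightarrow> nat \<Rightarrow> nat \<Rightarrow> complex \<Rightarrow> complex" where
  "srg_mu k a c l = of_nat k - of_nat c + (of_nat a - of_nat c) * l - l\<^sup>2"

text \<open>Indices \<open>IW j\<close> with \<open>srg_mu\<close> equal to zero are left out
  because they would belong to zero vectors. The set refers only to parameters, \<open>J\<close> and
  \<open>ev\<close>, so two graphs that share these data share it.\<close>

definition idx0 :: "nat \<Rightarrow> nat \<Rightarrow> nat \<Rightarrow> 'l set \<Rightarrow> ('l \<Rightarrow> complex) \<Rightarrow> ('l, 'q) idx set" where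
  "idx0 k a c J ev = {X0, X1, X2} \<union> IU ` J \<union> IW ` {j \<in> J. srg_mu k a c (ev j) \<noteq> 0}"

primrec diag_val :: "nat \<Rightarrow> nat \<Rightarrow> nat \<Rightarrow> ('l \<Rightarrow> complex) \<Rightarrow> ('q \<Rightarrow> complex) \<Rightarrow> ('l, 'q) idx \<Rightarrow> complex" where
  "diag_val k a c ev th X0 = 0"
| "diag_val k a c ev th X1 = of_nat a"
| "diag_val k a c ev th X2 = of_nat k - of_nat c"
| "diag_val k a c ev th (IU j) = ev j"
| "diag_val k a c ev th (IW j) = of_nat a - of_nat c - ev j"
| "diag_val k a c ev th (IZ q) = th q"

locale srg_vertex =
  fixes X :: "'a set" and E :: "'a \<Rightarrow> 'a \<Rightarrow> bool" and n k a c :: nat and x :: 'a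
  assumes srg: "strongly_regular X E n k a c" and x: "x \<in> X"
begin

abbreviation A :: "('a \<Rightarrow> complex) \<Rightarrow> 'a \<Rightarrow> complex" where
  "A \<equiv> mvmult X (adj_mat X E)"

definition D1 :: "'a set" where "D1 = nbhd X E x"

definition D2 :: "'a set" where "D2 = X - insert x D1"

definition S1 :: "('a \<Rightarrow> complex) set" where
  "S1 = {u \<in> vecs D1. ip X (ind D1) u = 0}"

lemma fin: "finite X" and E_in: "E y z \<Longrightarrow> y \<in> X \<and> z \<in> X" and E_comm: "E y z = E z y"
  and E_irrefl: "\<not> E y y" and card_X: "card X = n"
  and card_nbhd: "y \<in> X \<Longrightarrow> card (nbhd X E y) = k"
  and card_adj: "E y z \<Longrightarrow> card (nbhd X E y \<inter> nbhd X E z) = a"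
  and card_nonadj: "y \<in> X \<Longrightarrow> z \<in> X \<Longrightarrow> y \<noteq> z \<Longrightarrow> \<not> E y z \<Longrightarrow> card (nbhd X E y \<inter> nbhd X E z) = c"
proof -
  note s = srg[unfolded strongly_regular_def simple_graph_def]
  show "finite X" "E y z \<Longrightarrow> y \<in> X \<and> z \<in> X" "\<not> E y y" "card X = n" "y \<in> X \<Longrightarrow> card (nbhd X E y) = k"
    "y \<in> X \<Longrightarrow> z \<in> X \<Longrightarrow> y \<noteq> z \<Longrightarrow> \<not> E y z \<Longrightarrow> card (nbhd X E y \<inter> nbhd X E z) = c"
    using s by simp_all
  show "E y z = E z y" using s by metis
  show "E y z \<Longrightarrow> card (nbhd X E y \<inter> nbhd X E z) = a" using s by simp
qed

lemma x_notin_D1: "x \<notin> D1" and D1_sub: "D1 \<subseteq> X" and D2_sub: "D2 \<subseteq> X"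
  and D12: "D1 \<inter> D2 = {}" "D2 \<inter> D1 = {}" and xD2: "x \<notin> D2" and X_eq: "X = insert x (D1 \<union> D2)"
  using x E_irrefl by (auto simp: D1_def D2_def nbhd_def)

lemma A_vecs: "A v \<in> vecs X"
  by (rule mvmult_vecs[OF adj_mat_mats])

lemma A_self_adjoint: "ip X u (A v) = ip X (A u) v"
proof -
  have sym: "adj_mat X E y z = adj_mat X E z y" for y z
    using E_comm[of y z] by (auto simp: adj_mat_def)
  have cnj: "cnj (adj_mat X E y z) = adj_mat X E y z" for y z
    by (simp add: adj_mat_def)
  have "ip X u (A v) = (\<Sum>y\<in>X. \<Sum>z\<in>X. cnj (u y) * adj_mat X E y z * v z)"
    by (simp add: ip_def mvmult_def sum_distrib_left mult.assoc)
  also have "\<dots> = (\<Sum>z\<in>X. \<Sum>y\<in>X. cnj (u y) * adj_mat X E y z * v z)" by (rule sum.swap)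
  also have "\<dots> = ip X (A u) v"
    unfolding ip_def mvmult_def cnj_sum sum_distrib_right
  proof (intro sum.cong refl)
    fix y z show "cnj (u z) * adj_mat X E z y * v y = cnj (adj_mat X E y z * u z) * v y"
      using sym[of z y] by (simp add: cnj)
  qed
  finally show ?thesis .
qed

lemma card_D1: "card D1 = k" and card_D2: "card D2 = n - Suc k" and k_pos: "k > 0"
  and n_gt: "n > Suc k"
proof -
  show "card D1 = k" unfolding D1_def by (rule card_nbhd[OF x])
  then show "card D2 = n - Suc k"
    unfolding D2_def using fin D1_sub x x_notin_D1 card_X
    by (subst card_Diff_subset) (auto simp: finite_subset[OF D1_sub fin])
  obtain y z where "E y z" using srg unfolding strongly_regular_def by blast
  then have "z \<in> nbhd X E y" "y \<in> X" using E_in by (auto simp: nbhd_def)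
  then show "k > 0" using card_nbhd[of y] fin by (auto simp: nbhd_def card_gt_0_iff)
  obtain y z where yz: "y \<in> X" "z \<in> X" "y \<noteq> z" "\<not> E y z"
    using srg unfolding strongly_regular_def by blast
  then have "card (insert y (insert z (nbhd X E y))) = Suc (Suc k)"
    using card_nbhd[of y] fin E_irrefl by (simp add: nbhd_def)
  moreover have "card (insert y (insert z (nbhd X E y))) \<le> card X"
    using yz fin by (intro card_mono) (auto simp: nbhd_def)
  ultimately show "n > Suc k" using card_X by simp
qed

lemma D1_ne: "D1 \<noteq> {}" and D2_ne: "D2 \<noteq> {}"
  using card_D1 card_D2 k_pos n_gt by auto

lemma ip_ind: "Y \<subseteq> X \<Longrightarrow> ip X (ind Y) v = (\<Sum>y\<in>Y. v y)"
  using ip_superset[OF fin, of Y "ind Y" v] ind_vecs[of Y Y] by (simp add: ip_def ind_def)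

text \<open>Entry (y, z) of the squared adjacency matrix counts the common neighbours of
  \<open>y\<close> and \<open>z\<close>, which is k, a or c according as they are equal, adjacent or
  neither; the last summand is the action of c J.\<close>

lemma A_square:
  assumes v: "v \<in> vecs X"
  shows "A (A v) = (\<lambda>y. (of_nat k - of_nat c) * v y + (of_nat a - of_nat c) * A v y
    + of_nat c * ip X (ind X) v * ind X y)"
proof
  fix y
  show "A (A v) y = (of_nat k - of_nat c) * v y + (of_nat a - of_nat c) * A v y
    + of_nat c * ip X (ind X) v * ind X y"
  proof (cases "y \<in> X")
    case False
    with v A_vecs[of v] A_vecs[of "A v"] show ?thesis by (simp add: vecs_def ind_def)
  next
    case True
    have mm: "mmult X (adj_mat X E) (adj_mat X E) y z
      = (of_nat k - of_nat c) * (if z = y then 1 else 0) + (of_nat a - of_nat c) * adj_mat X E y z + of_nat c"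
      if z: "z \<in> X" for z
    proof -
      have "mmult X (adj_mat X E) (adj_mat X E) y z = (\<Sum>w\<in>X. if w \<in> nbhd X E y \<inter> nbhd X E z then 1 else 0)"
        unfolding mmult_def using True z
        by (intro sum.cong) (auto simp: adj_mat_def nbhd_def E_comm[of z])
      also have "\<dots> = of_nat (card (nbhd X E y \<inter> nbhd X E z))"
        using fin by (subst sum.inter_restrict[symmetric]) (auto simp: nbhd_def intro!: arg_cong[of _ _ card])
      finally show ?thesis
        using True z card_nbhd[of y] card_adj[of y z] card_nonadj[of y z] E_irrefl
        by (auto simp: adj_mat_def)
    qed
    have "A (A v) y = (\<Sum>z\<in>X. mmult X (adj_mat X E) (adj_mat X E) y z * v z)"
      unfolding mvmult_mmult[symmetric] by (simp add: mvmult_def)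
    also have "\<dots> = (\<Sum>z\<in>X. (of_nat k - of_nat c) * (if z = y then v z else 0)
        + (of_nat a - of_nat c) * (adj_mat X E y z * v z) + of_nat c * v z)"
      by (intro sum.cong refl) (simp add: mm algebra_simps)
    also have "\<dots> = (of_nat k - of_nat c) * v y + (of_nat a - of_nat c) * A v y + of_nat c * (\<Sum>z\<in>X. v z)"
      using fin True by (simp add: sum.distrib sum_distrib_left[symmetric] mvmult_def)
    finally show ?thesis using True by (simp add: ip_ind) (simp add: ind_def)
  qed
qed

lemma A_single: "A (ind {x}) = ind D1"
  using x by (subst mvmult_ind_single[OF fin x]) (auto simp: adj_mat_def ind_def D1_def nbhd_def fun_eq_iff E_comm[of x])

lemma A_ind_X: "A (ind X) = (\<lambda>y. of_nat k * ind X y)"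
proof
  fix y
  show "A (ind X) y = of_nat k * ind X y"
  proof (cases "y \<in> X")
    case True
    have "A (ind X) y = (\<Sum>z\<in>X. if z \<in> nbhd X E y then 1 else 0)"
      unfolding mvmult_def using True by (intro sum.cong) (auto simp: adj_mat_def ind_def nbhd_def)
    also have "\<dots> = of_nat (card (nbhd X E y))"
      using fin by (subst sum.inter_restrict[symmetric]) (auto simp: nbhd_def intro!: arg_cong[of _ _ card])
    finally show ?thesis using True by (simp add: card_nbhd ind_def)
  next
    case False
    with A_vecs[of "ind X"] show ?thesis by (simp add: vecs_def ind_def)
  qed
qed

lemma ind_X: "ind X = (\<lambda>y. ind {x} y + ind D1 y + ind D2 y)"
  using X_eq x_notin_D1 xD2 D12 by (auto simp: ind_def fun_eq_iff)

text \<open>Since \<open>ind D1\<close> is \<open>A (ind {x})\<close>, this is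
  \<open>A_square\<close> evaluated at \<open>ind {x}\<close>.\<close>

lemma A_ind_D1: "A (ind D1) = (\<lambda>y. of_nat k * ind {x} y + of_nat a * ind D1 y + of_nat c * ind D2 y)"
proof -
  have "ind {x} \<in> vecs X" using x by (intro ind_vecs) simp
  moreover have "ip X (ind X) (ind {x}) = 1"
    using x fin by (simp add: ip_ind) (simp add: ind_def)
  ultimately show ?thesis
    using A_square[of "ind {x}"] by (simp add: A_single ind_X fun_eq_iff algebra_simps)
qed

text \<open>Subtraction of the two preceding spheres from \<open>A (ind X)\<close>, which is k times
  \<open>ind X\<close>.\<close>

lemma A_ind_D2: "A (ind D2)
  = (\<lambda>y. (of_nat k - 1 - of_nat a) * ind D1 y + (of_nat k - of_nat c) * ind D2 y)"
proof -
  have "ind D2 = (\<lambda>y. 1 * ind X y + (-1) * (1 * ind {x} y + 1 * ind D1 y))"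
    by (simp add: ind_X)
  then have "A (ind D2) = A (\<lambda>y. 1 * ind X y + (-1) * (1 * ind {x} y + 1 * ind D1 y))" by simp
  also have "\<dots> = (\<lambda>y. 1 * A (ind X) y + (-1) * (1 * A (ind {x}) y + 1 * A (ind D1) y))"
    by (simp only: lin_on_comb[OF lin_on_mvmult[of UNIV] UNIV_I UNIV_I])
  also have "\<dots> = (\<lambda>y. (of_nat k - 1 - of_nat a) * ind D1 y + (of_nat k - of_nat c) * ind D2 y)"
    unfolding A_ind_X A_single A_ind_D1 by (simp add: ind_X fun_eq_iff algebra_simps)
  finally show ?thesis .
qed

lemma A_at_x: "A v x = ip X (ind D1) v"
proof -
  have "A v x = ip X (ind {x}) (A v)" using x by (simp add: ip_ind)
  then show ?thesis by (simp add: A_self_adjoint A_single)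
qed

lemma subsp_S1: "subsp S1"
  using subsp_vecs[of D1] by (auto simp: subsp_def S1_def ip_comb_right)

lemma S1_vecs: "S1 \<subseteq> vecs X"
  using D1_sub vecs_mono by (auto simp: S1_def)

lemma S1_orth_ind_X:
  assumes "u \<in> S1"
  shows "ip X (ind X) u = 0"
proof -
  have "cut D1 (ind X) = ind D1" using D1_sub by (auto simp: cut_def ind_def fun_eq_iff)
  with ip_cut_left[of u D1 X "ind X"] assms show ?thesis by (simp add: S1_def)
qed

text \<open>Cutting \<open>A v\<close> back to \<open>D1\<close> gives the adjacency operator of the
  local graph. It is self-adjoint, and it preserves the complement \<open>S1\<close> of the all-ones
  vector because that vector is a local eigenvector with eigenvalue a.\<close>

lemma local_eigenbasis:
  "\<exists>B ev. orth_basis X S1 B (\<lambda>b. b) \<and> (\<forall>b\<in>B. cut D1 (A b) = (\<lambda>y. ev b * b y))"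
proof (rule self_adjoint_eigenbasis[OF fin subsp_S1 S1_vecs])
  show "lin_on S1 (\<lambda>v. cut D1 (A v))"
    using lin_on_comb[OF lin_on_mvmult[of S1 X "adj_mat X E"]] lin_on_comb[OF lin_on_cut[of UNIV D1]]
    by (simp add: lin_on_def)
  show "cut D1 (A v) \<in> S1" if "v \<in> S1" for v
  proof -
    have "ip X (ind D1) (cut D1 (A v)) = ip X (A (ind D1)) v"
      by (simp add: ip_cut_right ind_vecs A_self_adjoint)
    also have "\<dots> = of_nat a * ip X (ind D1) v"
    proof -
      have "A (ind D1) = (\<lambda>y. 1 * (of_nat k * ind {x} y + of_nat a * ind D1 y) + of_nat c * ind D2 y)"
        by (simp add: A_ind_D1)
      moreover have "ip X (ind {x}) v = 0" "ip X (ind D2) v = 0"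
        using that x_notin_D1 D12 ind_vecs[of "{x}" "{x}"] ind_vecs[of D2 D2]
        by (auto simp: S1_def intro!: ip_disjoint)
      ultimately show ?thesis by (simp only: ip_comb_left) simp
    qed
    finally show ?thesis using that by (simp add: S1_def cut_vecs)
  qed
  show "ip X u (cut D1 (A v)) = ip X (cut D1 (A u)) v" if "u \<in> S1" "v \<in> S1" for u v
    using that by (simp add: S1_def ip_cut_right ip_cut_left A_self_adjoint)
qed

text \<open>The definition of \<open>local_adj\<close> hides an enumeration of the neighbours behind
  \<open>SOME\<close>. Exposing it makes the results on \<open>mat_on\<close>, valid for any
  enumeration, applicable.\<close>

lemma local_spectrum_mat_on:
  obtains vs where "distinct vs" "set vs = D1"
    "local_spectrum X E x = proots (char_poly (mat_on vs (adj_mat X E)))"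
proof -
  define vs where "vs = (SOME vs. distinct vs \<and> set vs = nbhd X E x)"
  have "\<exists>vs. distinct vs \<and> set vs = nbhd X E x"
    using finite_distinct_list[OF finite_subset[OF D1_sub fin]] by (auto simp: D1_def)
  from someI_ex[OF this] have vs: "distinct vs" "set vs = D1" by (auto simp: vs_def D1_def)
  have "vs ! i \<in> X" if "i < length vs" for i using that vs(2) D1_sub nth_mem by blast
  then have "mat_on vs (adj_mat X E) = local_adj X E x"
    unfolding mat_on_def local_adj_def vs_def[symmetric] Let_def
    by (intro eq_matI) (auto simp: adj_mat_def)
  with vs that show thesis by (simp add: local_spectrum_def)
qed

lemma A_local:
  assumes "v \<in> vecs D1"
  shows "mvmult D1 (adj_mat X E) v = A v"
  unfolding mvmult_def using fin D1_sub assms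
  by (intro ext sum.mono_neutral_left) (auto simp: vecs_def)

end

section \<open>The orthogonal basis adapted to a vertex\<close>

text \<open>The local eigenbasis is a family over an abstract index set \<open>J\<close>, not a set
  of vectors, so that a second graph can be instantiated with the same \<open>J\<close> and
  \<open>ev\<close>.\<close>

locale srg_local = srg_vertex X E n k a c x
  for X :: "'a set" and E :: "'a \<Rightarrow> 'a \<Rightarrow> bool" and n k a c :: nat and x :: 'a +
  fixes J :: "'l set" and u :: "'l \<Rightarrow> 'a \<Rightarrow> complex" and ev :: "'l \<Rightarrow> complex"
  assumes basis: "orth_basis X S1 J u"
    and eig: "j \<in> J \<Longrightarrow> cut D1 (A (u j)) = (\<lambda>y. ev j * u j y)"
begin

definition W :: "'l \<Rightarrow> 'a \<Rightarrow> complex" where "W j = cut D2 (A (u j))"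

definition perp :: "('a \<Rightarrow> complex) set" where
  "perp = {v \<in> vecs X. ip X (ind {x}) v = 0 \<and> ip X (ind D1) v = 0 \<and> ip X (ind D2) v = 0
     \<and> (\<forall>j\<in>J. ip X (u j) v = 0 \<and> ip X (W j) v = 0)}"

lemma fin_J: "finite J" and u_S1: "j \<in> J \<Longrightarrow> u j \<in> S1" and u_ne: "j \<in> J \<Longrightarrow> u j \<noteq> (\<lambda>_. 0)"
  and u_orth: "i \<in> J \<Longrightarrow> j \<in> J \<Longrightarrow> i \<noteq> j \<Longrightarrow> ip X (u i) (u j) = 0"
  and u_complete: "v \<in> S1 \<Longrightarrow> (\<And>j. j \<in> J \<Longrightarrow> ip X (u j) v = 0) \<Longrightarrow> v = (\<lambda>_. 0)"
  using basis by (auto simp: orth_basis_def)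

lemma u_vecs: "j \<in> J \<Longrightarrow> u j \<in> vecs D1" and u_ind: "j \<in> J \<Longrightarrow> ip X (ind D1) (u j) = 0"
  using u_S1 by (auto simp: S1_def)

lemma u_vecs_X: "j \<in> J \<Longrightarrow> u j \<in> vecs X"
  using u_S1 S1_vecs by auto

lemma W_vecs: "W j \<in> vecs D2"
  by (simp add: W_def cut_vecs)

lemma W_vecs_X: "W j \<in> vecs X"
  using vecs_mono[OF W_vecs D2_sub] .

lemma ip_D1_D2: "v \<in> vecs D1 \<Longrightarrow> w \<in> vecs D2 \<Longrightarrow> ip X v w = 0"
  by (rule ip_disjoint[OF _ _ D12(1)])

lemma ip_D2_D1: "v \<in> vecs D1 \<Longrightarrow> w \<in> vecs D2 \<Longrightarrow> ip X w v = 0"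
  by (rule ip_disjoint[OF _ _ D12(2)])

text \<open>Sphere by sphere: the value at \<open>x\<close> is the inner product with
  \<open>ind D1\<close>, hence zero; on \<open>D1\<close> the local eigenvalue equation applies; the
  part on \<open>D2\<close> is \<open>W j\<close>.\<close>

lemma A_u:
  assumes j: "j \<in> J"
  shows "A (u j) = (\<lambda>y. ev j * u j y + W j y)"
proof
  fix y
  consider "y = x" | "y \<in> D1" | "y \<in> D2" | "y \<notin> X" using X_eq by auto
  then show "A (u j) y = ev j * u j y + W j y"
  proof cases
    case 1
    then show ?thesis using u_vecs[OF j] u_ind[OF j] x_notin_D1 xD2
      by (simp add: A_at_x W_def cut_def vecs_def)
  next
    case 2
    then show ?thesis using fun_cong[OF eig[OF j], of y] D12 by (auto simp: W_def cut_def)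
  next
    case 3
    then have "u j y = 0" using u_vecs[OF j] D12 by (auto simp: vecs_def)
    with 3 show ?thesis by (simp add: W_def cut_def)
  next
    case 4
    then show ?thesis using u_vecs_X[OF j] W_vecs_X A_vecs by (simp add: vecs_def)
  qed
qed

text \<open>Writing \<open>W j\<close> as \<open>A (u j)\<close> minus \<open>ev j\<close> times
  \<open>u j\<close> reduces the claim to \<open>A_square\<close>, whose J term drops out because
  \<open>u j\<close> is orthogonal to \<open>ind X\<close>.\<close>

lemma A_W:
  assumes j: "j \<in> J"
  shows "A (W j) = (\<lambda>y. srg_mu k a c (ev j) * u j y + (of_nat a - of_nat c - ev j) * W j y)"
proof -
  have "W j = (\<lambda>y. 1 * A (u j) y + (- ev j) * u j y)" by (simp add: A_u[OF j])
  then have "A (W j) = A (\<lambda>y. 1 * A (u j) y + (- ev j) * u j y)" by simp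
  also have "\<dots> = (\<lambda>y. 1 * A (A (u j)) y + (- ev j) * A (u j) y)"
    by (intro lin_on_comb[OF lin_on_mvmult[of UNIV]]) auto
  also have "\<dots> = (\<lambda>y. srg_mu k a c (ev j) * u j y + (of_nat a - of_nat c - ev j) * W j y)"
    unfolding A_square[OF u_vecs_X[OF j]]
    unfolding A_u[OF j]
    by (simp add: S1_orth_ind_X[OF u_S1[OF j]] srg_mu_def fun_eq_iff algebra_simps power2_eq_square)
  finally show ?thesis .
qed

text \<open>Moving \<open>A\<close> across the inner product leaves \<open>A (W i)\<close> paired
  with \<open>u j\<close>, and only the component on \<open>D1\<close> contributes. Orthogonality
  and vanishing of the \<open>W j\<close> thus reduce to the \<open>u j\<close> and
  \<open>srg_mu\<close>.\<close>

lemma ip_W: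
  assumes "i \<in> J" "j \<in> J"
  shows "ip X (W i) (W j) = cnj (srg_mu k a c (ev i)) * ip X (u i) (u j)"
proof -
  have "ip X (W i) (W j) = ip X (W i) (A (u j))"
    unfolding W_def[of j] by (rule ip_cut_right[OF W_vecs])
  also have "\<dots> = ip X (A (W i)) (u j)" by (rule A_self_adjoint)
  finally show ?thesis
    unfolding A_W[OF assms(1)] by (simp add: ip_comb_left ip_D2_D1[OF u_vecs[OF assms(2)] W_vecs])
qed

lemma W_eq_0_iff:
  assumes j: "j \<in> J"
  shows "W j = (\<lambda>_. 0) \<longleftrightarrow> srg_mu k a c (ev j) = 0"
proof
  assume "W j = (\<lambda>_. 0)"
  with ip_W[OF j j] show "srg_mu k a c (ev j) = 0"
    using ip_self_eq_0[OF fin u_vecs_X[OF j]] u_ne[OF j] by auto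
next
  assume "srg_mu k a c (ev j) = 0"
  with ip_W[OF j j] ip_self_eq_0[OF fin W_vecs_X] show "W j = (\<lambda>_. 0)" by simp
qed

text \<open>After moving \<open>A\<close> to the left, only the multiple of \<open>ind D1\<close> in
  \<open>A (ind D2)\<close> meets the support of \<open>u j\<close>, and \<open>u j\<close> is
  orthogonal to it.\<close>

lemma ind_D2_W: "j \<in> J \<Longrightarrow> ip X (ind D2) (W j) = 0"
proof -
  assume j: "j \<in> J"
  have "ip X (ind D2) (W j) = ip X (A (ind D2)) (u j)"
    unfolding W_def by (simp add: ip_cut_right ind_vecs A_self_adjoint)
  also have "\<dots> = 0"
    unfolding A_ind_D2 ip_comb_left using u_ind[OF j] ip_D2_D1[OF u_vecs[OF j], of "ind D2"]
    by (simp add: ind_vecs)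
  finally show ?thesis .
qed

lemma subsp_perp: "subsp perp"
  using subsp_vecs[of X] by (auto simp: subsp_def perp_def ip_comb_right)

text \<open>The part of \<open>v\<close> on \<open>D1\<close> lies in \<open>S1\<close> and is
  orthogonal to the complete family \<open>u\<close>, so it vanishes; the value at \<open>x\<close>
  vanishes by orthogonality to \<open>ind {x}\<close>.\<close>

lemma perp_D2:
  assumes v: "v \<in> perp"
  shows "v \<in> vecs D2"
proof -
  have "ip X (u j) (cut D1 v) = 0" if "j \<in> J" for j
    using v that by (simp add: ip_cut_right[OF u_vecs] perp_def)
  moreover have "cut D1 v \<in> S1"
    using v by (simp add: S1_def cut_vecs ip_cut_right ind_vecs perp_def)
  ultimately have "cut D1 v = (\<lambda>_. 0)" by (intro u_complete)
  moreover have "v x = 0" using v x by (simp add: perp_def ip_ind)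
  moreover have "v \<in> vecs X" using v by (simp add: perp_def)
  ultimately show ?thesis using X_eq
    by (auto simp: vecs_def cut_def fun_eq_iff) (metis UnE insertE)
qed

lemma perp_ind_X: "v \<in> perp \<Longrightarrow> ip X (ind X) v = 0"
  using ip_comb_left[of X 1 "\<lambda>y. 1 * ind {x} y + 1 * ind D1 y" 1 "ind D2" v]
  by (simp add: ip_comb_left[of X 1 _ 1, simplified] ind_X perp_def)

text \<open>\<open>A\<close> maps each vector defining \<open>perp\<close> to a combination of such
  vectors, and \<open>A\<close> is self-adjoint.\<close>

lemma perp_A:
  assumes v: "v \<in> perp"
  shows "A v \<in> perp"
proof -
  have vs: "ip X (ind {x}) v = 0" "ip X (ind D1) v = 0" "ip X (ind D2) v = 0"
    "\<And>j. j \<in> J \<Longrightarrow> ip X (u j) v = 0" "\<And>j. j \<in> J \<Longrightarrow> ip X (W j) v = 0"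
    using v by (auto simp: perp_def)
  have "A (ind D1) = (\<lambda>y. 1 * (of_nat k * ind {x} y + of_nat a * ind D1 y) + of_nat c * ind D2 y)"
    by (simp add: A_ind_D1)
  then have "ip X (A (ind D1)) v = 0" by (simp only: ip_comb_left vs) simp
  moreover have "ip X (A (ind D2)) v = 0" unfolding A_ind_D2 by (simp add: ip_comb_left vs)
  moreover have "ip X (A (u j)) v = 0" if "j \<in> J" for j
    unfolding A_u[OF that] using ip_comb_left[of X "ev j" "u j" 1 "W j" v] vs(4,5)[OF that] by simp
  moreover have "ip X (A (W j)) v = 0" if "j \<in> J" for j
    unfolding A_W[OF that] by (simp add: ip_comb_left vs(4,5)[OF that])
  ultimately show ?thesis
    unfolding perp_def by (simp add: A_self_adjoint A_single vs A_vecs)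
qed

text \<open>Vectors of \<open>perp\<close> are orthogonal to \<open>ind X\<close>, so on them
  \<open>A_square\<close> loses its J term and becomes a quadratic equation for every
  eigenvalue.\<close>

lemma perp_eigenbasis:
  "\<exists>B th. orth_basis X perp B (\<lambda>b. b) \<and> (\<forall>b\<in>B. A b = (\<lambda>y. th b * b y)
     \<and> (th b)\<^sup>2 = (of_nat a - of_nat c) * th b + (of_nat k - of_nat c))"
proof -
  have "perp \<subseteq> vecs X" by (auto simp: perp_def)
  from self_adjoint_eigenbasis[OF fin subsp_perp this lin_on_mvmult perp_A A_self_adjoint]
  obtain B th where B: "orth_basis X perp B (\<lambda>b. b)" "\<And>b. b \<in> B \<Longrightarrow> A b = (\<lambda>y. th b * b y)"
    by blast
  have "(th b)\<^sup>2 = (of_nat a - of_nat c) * th b + (of_nat k - of_nat c)" if b: "b \<in> B" for b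
  proof -
    have bp: "b \<in> perp" "b \<noteq> (\<lambda>_. 0)" using B(1) b by (auto simp: orth_basis_def)
    then obtain y where y: "b y \<noteq> 0" by auto
    have "b \<in> vecs X" using bp by (simp add: perp_def)
    from A_square[OF this] have "A (\<lambda>y. th b * b y) y
        = (of_nat k - of_nat c) * b y + (of_nat a - of_nat c) * (th b * b y)"
      using perp_ind_X[OF bp(1)] by (simp add: B(2)[OF b])
    moreover have "A (\<lambda>y. th b * b y) = (\<lambda>y. th b * (th b * b y))"
      using lin_on_smult[OF lin_on_mvmult[of UNIV], of b] by (simp add: B(2)[OF b])
    ultimately have "(th b)\<^sup>2 * b y = ((of_nat a - of_nat c) * th b + (of_nat k - of_nat c)) * b y"
      by (simp add: power2_eq_square algebra_simps)
    with y show ?thesis by simp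
  qed
  with B show ?thesis by blast
qed

section \<open>The adapted basis: completeness, dimension and trace\<close>

primrec fam :: "('q \<Rightarrow> 'a \<Rightarrow> complex) \<Rightarrow> ('l, 'q) idx \<Rightarrow> 'a \<Rightarrow> complex" where
  "fam z X0 = ind {x}" | "fam z X1 = ind D1" | "fam z X2 = ind D2"
| "fam z (IU j) = u j" | "fam z (IW j) = W j" | "fam z (IZ q) = z q"

definition sphere :: "nat \<Rightarrow> 'a set" where
  "sphere i = (if i = 0 then {x} else if i = 1 then D1 else if i = 2 then D2 else {})"

definition idx_all :: "'q set \<Rightarrow> ('l, 'q) idx set" where
  "idx_all Q = idx0 k a c J ev \<union> IZ ` Q"

lemma sphere_disjoint: "i \<noteq> j \<Longrightarrow> sphere i \<inter> sphere j = {}"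
  using x_notin_D1 xD2 D12 by (auto simp: sphere_def)

lemma sphere_sub: "sphere i \<subseteq> X"
  using X_eq by (auto simp: sphere_def)

context
  fixes z :: "'q \<Rightarrow> 'a \<Rightarrow> complex" and Q :: "'q set"
  assumes z: "orth_basis X perp Q z"
begin

lemma fam_sphere: "i \<in> idx_all Q \<Longrightarrow> fam z i \<in> vecs (sphere (lev i))"
  using u_vecs W_vecs perp_D2 z
  by (cases i) (auto simp: sphere_def ind_vecs idx_all_def idx0_def orth_basis_def)

text \<open>Vectors on different spheres have disjoint supports. Within a sphere the relations are
  those of \<open>u\<close>, of \<open>W\<close> via \<open>ip_W\<close>, and the definition of
  \<open>perp\<close>.\<close>

lemma fam_orth:
  assumes "i \<in> idx_all Q" "j \<in> idx_all Q" "i \<noteq> j"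
  shows "ip X (fam z i) (fam z j) = 0"
proof (cases "lev i = lev j")
  case False
  with fam_sphere[OF assms(1)] fam_sphere[OF assms(2)] sphere_disjoint show ?thesis
    by (intro ip_disjoint)
next
  case True
  have zp: "q \<in> Q \<Longrightarrow> z q \<in> perp" and zo: "q \<in> Q \<Longrightarrow> q' \<in> Q \<Longrightarrow> q \<noteq> q' \<Longrightarrow> ip X (z q) (z q') = 0" for q q'
    using z by (auto simp: orth_basis_def)
  have z2: "q \<in> Q \<Longrightarrow> ip X (ind D2) (z q) = 0" "q \<in> Q \<Longrightarrow> j \<in> J \<Longrightarrow> ip X (W j) (z q) = 0" for q j
    using zp by (auto simp: perp_def)
  note sym = u_ind[THEN ip_eq_0_sym] ind_D2_W[THEN ip_eq_0_sym] z2[THEN ip_eq_0_sym]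
  show ?thesis using True assms
    by (cases i; cases j)
      (auto simp: idx_all_def idx0_def u_ind ind_D2_W z2 sym zo u_orth ip_W)
qed

lemma fam_basis: "orth_basis X (vecs X) (idx_all Q) (fam z)"
  unfolding orth_basis_def
proof (intro conjI ballI impI)
  show "finite (idx_all Q)" using fin_J z by (auto simp: idx_all_def idx0_def orth_basis_def)
  fix i assume i: "i \<in> idx_all Q"
  show "fam z i \<in> vecs X" using vecs_mono[OF fam_sphere[OF i] sphere_sub] .
  have "ind Y \<noteq> (\<lambda>_. 0)" if "Y \<noteq> {}" for Y :: "'a set" using that by (auto simp: ind_def fun_eq_iff)
  then show "fam z i \<noteq> (\<lambda>_. 0)"
    using i D1_ne D2_ne u_ne W_eq_0_iff z
    by (cases i) (auto simp: idx_all_def idx0_def orth_basis_def)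
next
  fix i j assume "i \<in> idx_all Q" "j \<in> idx_all Q" "i \<noteq> j"
  then show "ip X (fam z i) (fam z j) = 0" by (rule fam_orth)
next
  fix v assume v: "v \<in> vecs X" "\<forall>i\<in>idx_all Q. ip X (fam z i) v = 0"
  have *: "ip X (fam z i) v = 0" if "i \<in> idx_all Q" for i using v that by blast
  \<comment> \<open>When \<open>srg_mu\<close> vanishes the index \<open>IW j\<close> is absent, but
    then \<open>W j\<close> is zero and the orthogonality required by \<open>perp\<close> is
    automatic.\<close>
  have "ip X (W j) v = 0" if "j \<in> J" for j
    using *[of "IW j"] W_eq_0_iff[OF that] that by (cases "srg_mu k a c (ev j) = 0") (auto simp: idx_all_def idx0_def)
  moreover have "ip X (u j) v = 0" if "j \<in> J" for j
    using *[of "IU j"] that by (auto simp: idx_all_def idx0_def)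
  ultimately have "v \<in> perp"
    using *[of X0] *[of X1] *[of X2] v(1) by (auto simp: perp_def idx_all_def idx0_def)
  moreover have "ip X (z q) v = 0" if "q \<in> Q" for q
    using *[of "IZ q"] that by (auto simp: idx_all_def)
  ultimately show "v = (\<lambda>_. 0)" using z by (simp add: orth_basis_def)
qed

text \<open>The other components of \<open>A (fam z i)\<close> are orthogonal to
  \<open>fam z i\<close>. Each diagonal coefficient in the trace formula is therefore a function of
  the parameters, \<open>ev\<close> and \<open>th\<close>.\<close>

lemma diag_fam:
  assumes i: "i \<in> idx_all Q" and th: "\<And>q. q \<in> Q \<Longrightarrow> A (z q) = (\<lambda>y. th q * z q y)"
  shows "ip X (fam z i) (A (fam z i)) = diag_val k a c ev th i * ip X (fam z i) (fam z i)"
proof (cases i)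
  case X0
  then show ?thesis using x_notin_D1 x by (simp add: A_single ip_ind) (simp add: ind_def)
next
  case X1
  have "A (ind D1) = (\<lambda>y. 1 * (of_nat k * ind {x} y + of_nat a * ind D1 y) + of_nat c * ind D2 y)"
    by (simp add: A_ind_D1)
  moreover have "ip X (ind D1) (ind {x}) = 0"
    using x_notin_D1 by (intro ip_disjoint[of _ D1 _ "{x}"] ind_vecs) auto
  ultimately show ?thesis
    using X1 by (simp only: fam.simps ip_comb_right) (simp add: ip_D1_D2 ind_vecs)
next
  case X2
  then show ?thesis by (simp add: A_ind_D2 ip_comb_right ip_D2_D1 ind_vecs)
next
  case (IU j)
  with i have j: "j \<in> J" by (auto simp: idx_all_def idx0_def)
  show ?thesis
    using IU ip_comb_right[of X "u j" "ev j" "u j" 1 "W j"]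
    by (simp add: A_u[OF j] ip_D1_D2[OF u_vecs[OF j] W_vecs])
next
  case (IW j)
  with i have j: "j \<in> J" by (auto simp: idx_all_def idx0_def)
  show ?thesis
    using IW by (simp add: A_W[OF j] ip_comb_right ip_D2_D1[OF u_vecs[OF j] W_vecs])
next
  case (IZ q)
  with i have q: "q \<in> Q" by (auto simp: idx_all_def idx0_def)
  show ?thesis using IZ by (simp add: th[OF q] ip_smult_right)
qed

lemma card_idx: "card (idx_all Q) = n"
  using orth_basis_card[OF fin fam_basis] card_X by simp

lemma sum_idx_all:
  fixes f :: "('l, 'q) idx \<Rightarrow> 'r::comm_monoid_add"
  shows "sum f (idx_all Q) = f X0 + f X1 + f X2 + (\<Sum>j\<in>J. f (IU j))
    + (\<Sum>j | j \<in> J \<and> srg_mu k a c (ev j) \<noteq> 0. f (IW j)) + (\<Sum>q\<in>Q. f (IZ q))"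
proof -
  let ?K = "{j \<in> J. srg_mu k a c (ev j) \<noteq> 0}"
  have "finite Q" using z by (simp add: orth_basis_def)
  then have "sum f (idx_all Q) = sum f {X0, X1, X2} + sum f (IU ` J) + sum f (IW ` ?K) + sum f (IZ ` Q)"
    unfolding idx_all_def idx0_def using fin_J
    by (subst sum.union_disjoint; (subst sum.union_disjoint)?; (subst sum.union_disjoint)?) auto
  then show ?thesis by (simp add: sum.reindex inj_on_def add.assoc)
qed

text \<open>Dimension count in which 3 stands for the sphere indicators; it makes
  \<open>card Q\<close> depend only on \<open>n\<close>, the other parameters, \<open>J\<close> and
  \<open>ev\<close>.\<close>

lemma card_Q: "3 + card J + card {j \<in> J. srg_mu k a c (ev j) \<noteq> 0} + card Q = n"
  using card_idx sum_idx_all[of "\<lambda>_. 1 :: nat"] by simp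

text \<open>The trace of the adjacency matrix vanishes.\<close>
lemma sum_th:
  assumes th: "\<And>q. q \<in> Q \<Longrightarrow> A (z q) = (\<lambda>y. th q * z q y)"
  shows "of_nat a + (of_nat k - of_nat c) + (\<Sum>j\<in>J. ev j)
    + (\<Sum>j | j \<in> J \<and> srg_mu k a c (ev j) \<noteq> 0. of_nat a - of_nat c - ev j) + (\<Sum>q\<in>Q. th q) = 0"
proof -
  have "0 = (\<Sum>y\<in>X. adj_mat X E y y)" using E_irrefl by (simp add: adj_mat_def)
  also have "\<dots> = (\<Sum>i\<in>idx_all Q. ip X (fam z i) (A (fam z i)) / ip X (fam z i) (fam z i))"
    by (rule orth_basis_trace[OF fin fam_basis, symmetric])
  also have "\<dots> = (\<Sum>i\<in>idx_all Q. diag_val k a c ev th i)"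
    using orth_basis_coeff[OF fin fam_basis subset_refl]
    by (intro sum.cong refl) (simp add: diag_fam th)
  finally show ?thesis unfolding sum_idx_all by simp
qed

end

text \<open>Adjoining the all-ones vector, with eigenvalue a, to the basis of \<open>S1\<close>
  gives an orthogonal eigenbasis of the local graph. In the proof \<open>None\<close> indexes that
  extra vector.\<close>

lemma local_spectrum_eq: "local_spectrum X E x = add_mset (of_nat a) (image_mset ev (mset_set J))"
proof -
  obtain vs where vs: "distinct vs" "set vs = D1"
    and spec: "local_spectrum X E x = proots (char_poly (mat_on vs (adj_mat X E)))"
    by (rule local_spectrum_mat_on)
  define b where "b = (\<lambda>i. case i of None \<Rightarrow> ind D1 | Some j \<Rightarrow> u j)"
  define ev' where "ev' = (\<lambda>i. case i of None \<Rightarrow> of_nat a | Some j \<Rightarrow> ev j)"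
  let ?I = "insert None (Some ` J)"
  have bD1: "b i \<in> vecs D1" if "i \<in> ?I" for i using that u_vecs by (auto simp: b_def ind_vecs)
  have ipD1: "ip D1 v w = ip X v w" if "v \<in> vecs D1" for v w
    using ip_superset[OF fin D1_sub that] by simp
  have "orth_basis D1 (vecs D1) ?I b"
    unfolding orth_basis_def
  proof (intro conjI ballI impI)
    show "finite ?I" using fin_J by simp
    fix i assume i: "i \<in> ?I"
    show "b i \<in> vecs D1" by (rule bD1[OF i])
    have "ind D1 \<noteq> (\<lambda>_. 0)" using D1_ne by (auto simp: ind_def fun_eq_iff)
    then show "b i \<noteq> (\<lambda>_. 0)" using i u_ne by (auto simp: b_def)
    fix j assume j: "j \<in> ?I" "i \<noteq> j"
    show "ip D1 (b i) (b j) = 0"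
      unfolding ipD1[OF bD1[OF i]] using i j by (cases i; cases j) (auto simp: b_def u_ind u_ind[THEN ip_eq_0_sym] u_orth)
  next
    fix v assume v: "v \<in> vecs D1" "\<forall>i\<in>?I. ip D1 (b i) v = 0"
    have *: "ip X (b i) v = 0" if "i \<in> ?I" for i
      using bspec[OF v(2) that] ipD1[OF bD1[OF that], of v] by simp
    then have "v \<in> S1" using v(1) *[of None] by (simp add: S1_def b_def)
    then show "v = (\<lambda>_. 0)"
    proof (rule u_complete)
      fix j assume "j \<in> J" then show "ip X (u j) v = 0" using *[of "Some j"] by (simp add: b_def)
    qed
  qed
  moreover have "mvmult D1 (adj_mat X E) (b i) y = ev' i * b i y" if i: "i \<in> ?I" and y: "y \<in> D1" for i y
  proof -
    have "mvmult D1 (adj_mat X E) (b i) y = A (b i) y" by (simp add: A_local bD1[OF i])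
    also have "\<dots> = ev' i * b i y"
    proof (cases i)
      case None
      then show ?thesis using y x_notin_D1 D12 by (auto simp: b_def ev'_def A_ind_D1) (auto simp: ind_def)
    next
      case (Some j)
      with i have j: "j \<in> J" by auto
      from y have "y \<notin> D2" using D12 by auto
      then have "W j y = 0" using W_vecs[of j] by (simp add: vecs_def)
      then show ?thesis using Some by (simp add: b_def ev'_def A_u[OF j])
    qed
    finally show ?thesis .
  qed
  ultimately have "local_spectrum X E x = image_mset ev' (mset_set ?I)"
    unfolding spec by (rule proots_char_poly_orth_basis[OF vs])
  also have "mset_set ?I = add_mset None (image_mset Some (mset_set J))"
    using fin_J by (simp add: image_mset_mset_set)
  finally show ?thesis by (simp add: ev'_def image_mset.compositionality o_def)
qed

end

section \<open>Distances and the intertwining map\<close>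

lemma walk_betw_0: "walk_betw X E x y 0 \<longleftrightarrow> x = y \<and> x \<in> X"
proof
  assume "walk_betw X E x y 0"
  then show "x = y \<and> x \<in> X" unfolding walk_betw_def by (auto simp: length_Suc_conv)
next
  assume "x = y \<and> x \<in> X"
  then show "walk_betw X E x y 0" unfolding walk_betw_def by (intro exI[of _ "[x]"]) auto
qed

lemma walk_betw_1: "walk_betw X E x y (Suc 0) \<longleftrightarrow> x \<in> X \<and> y \<in> X \<and> E x y"
proof
  assume "walk_betw X E x y (Suc 0)"
  then show "x \<in> X \<and> y \<in> X \<and> E x y" unfolding walk_betw_def by (auto simp: length_Suc_conv)
next
  assume "x \<in> X \<and> y \<in> X \<and> E x y"
  then show "walk_betw X E x y (Suc 0)" unfolding walk_betw_def by (intro exI[of _ "[x, y]"]) auto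
qed

lemma walk_betw_2I:
  assumes "x \<in> X" "w \<in> X" "y \<in> X" "E x w" "E w y"
  shows "walk_betw X E x y 2"
  unfolding walk_betw_def using assms
  by (intro exI[of _ "[x, w, y]"]) (auto simp: numeral_2_eq_2 less_Suc_eq)

context srg_vertex
begin

text \<open>With c = 0 a walk starting at \<open>y\<close> could never leave \<open>y\<close> and
  its neighbours: the next vertex would be neither \<open>y\<close> nor adjacent to it and yet share
  a neighbour with it. This contradicts a walk to a distinct non-neighbour \<open>z\<close>.\<close>

lemma c_pos:
  assumes conn: "connected_graph X E"
  shows "c > 0"
proof (rule ccontr)
  assume c0: "\<not> c > 0"
  obtain y z where yz: "y \<in> X" "z \<in> X" "y \<noteq> z" "\<not> E y z"
    using srg unfolding strongly_regular_def by blast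
  obtain m xs where xs: "length xs = Suc m" "hd xs = y" "last xs = z" "set xs \<subseteq> X"
    "\<forall>i<m. E (xs ! i) (xs ! Suc i)"
    using conn yz unfolding connected_graph_def walk_betw_def by meson
  have "xs ! i = y \<or> E y (xs ! i)" if "i \<le> m" for i
    using that
  proof (induction i)
    case 0
    then show ?case using xs by (metis Suc_neq_Zero hd_conv_nth list.size(3))
  next
    case (Suc i)
    then have e: "E (xs ! i) (xs ! Suc i)" using xs(5) by simp
    from Suc have "xs ! i = y \<or> E y (xs ! i)" by simp
    then show ?case
    proof
      assume "E y (xs ! i)"
      with e have "xs ! i \<in> nbhd X E y \<inter> nbhd X E (xs ! Suc i)"
        using E_in by (auto simp: nbhd_def E_comm[of "xs ! Suc i"])
      then have "card (nbhd X E y \<inter> nbhd X E (xs ! Suc i)) \<noteq> 0"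
        using fin by (auto simp: nbhd_def)
      then show ?thesis using card_nonadj[of y "xs ! Suc i"] yz(1) E_in[OF e] c0 by auto
    qed (use e in auto)
  qed
  from this[of m] have "xs ! m = y \<or> E y (xs ! m)" by simp
  moreover have "xs ! m = z" using xs(1,3) by (metis diff_Suc_1 last_conv_nth list.size(3) Suc_neq_Zero)
  ultimately show False using yz by auto
qed

text \<open>Positivity of c provides a common neighbour of two distinct non-adjacent vertices, hence
  a walk of length two.\<close>

lemma gdist_eq:
  assumes conn: "connected_graph X E" and y: "y \<in> X"
  shows "gdist X E x y = (if y = x then 0 else if E x y then 1 else 2)"
proof -
  consider "y = x" | "y \<noteq> x" "E x y" | "y \<noteq> x" "\<not> E x y" by blast
  then show ?thesis
  proof cases
    case 1
    then have "gdist X E x y = 0"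
      unfolding gdist_def using x by (intro Least_equality) (auto simp: walk_betw_0)
    with 1 show ?thesis by simp
  next
    case 2
    then have "gdist X E x y = Suc 0"
      unfolding gdist_def
    proof (intro Least_equality)
      show "walk_betw X E x y (Suc 0)" using 2 x y by (simp add: walk_betw_1)
      fix m assume "walk_betw X E x y m"
      with 2 show "Suc 0 \<le> m" by (cases m) (auto simp: walk_betw_0)
    qed
    with 2 show ?thesis by simp
  next
    case 3
    then have "card (nbhd X E x \<inter> nbhd X E y) > 0"
      using card_nonadj[of x y] c_pos[OF conn] x y by auto
    then obtain w where w: "w \<in> nbhd X E x \<inter> nbhd X E y" by (auto simp: card_gt_0_iff)
    have "gdist X E x y = 2"
      unfolding gdist_def
    proof (intro Least_equality)
      show "walk_betw X E x y 2"
        using w x y E_comm[of y w] by (intro walk_betw_2I[of _ _ w]) (auto simp: nbhd_def)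
      fix m assume m: "walk_betw X E x y m"
      have "m \<noteq> 0" using m 3 by (metis walk_betw_0)
      moreover have "m \<noteq> Suc 0" using m 3 by (metis walk_betw_1)
      ultimately show "2 \<le> m" by simp
    qed
    with 3 show ?thesis by simp
  qed
qed

lemma mvmult_dual_idem: "mvmult X (dual_idem X E x i) v = cut {y \<in> X. gdist X E x y = i} v"
proof
  fix y
  have "mvmult X (dual_idem X E x i) v y = (\<Sum>z\<in>X. if z = y then cut {y \<in> X. gdist X E x y = i} v y else 0)"
    unfolding mvmult_def by (intro sum.cong) (auto simp: dual_idem_def cut_def)
  then show "mvmult X (dual_idem X E x i) v y = cut {y \<in> X. gdist X E x y = i} v y"
    using fin by (auto simp: cut_def)
qed

lemma dual_idem_0: "connected_graph X E \<Longrightarrow> mvmult X (dual_idem X E x 0) v = cut {x} v"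
  and dual_idem_1: "connected_graph X E \<Longrightarrow> mvmult X (dual_idem X E x 1) v = cut D1 v"
  and dual_idem_2: "connected_graph X E \<Longrightarrow> mvmult X (dual_idem X E x 2) v = cut D2 v"
  unfolding mvmult_dual_idem using x E_irrefl
  by (auto simp: gdist_eq D1_def D2_def nbhd_def split: if_splits intro!: arg_cong2[of _ _ _ _ cut])

text \<open>The scalar is the \<open>(x, x)\<close> entry of \<open>M\<close>, which is therefore an invariant of the algebra.\<close>
lemma compress_dual_idem_0:
  assumes "connected_graph X E" "M \<in> mats X"
  shows "mmult X (dual_idem X E x 0) (mmult X M (dual_idem X E x 0))
    = (\<lambda>y z. mvmult X M (ind {x}) x * dual_idem X E x 0 y z)"
proof (rule mats_eqI[OF fin])
  show "mmult X (dual_idem X E x 0) (mmult X M (dual_idem X E x 0)) \<in> mats X"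
    by (intro mats_closed dual_idem_mats assms)
  show "(\<lambda>y z. mvmult X M (ind {x}) x * dual_idem X E x 0 y z) \<in> mats X"
    by (intro mats_closed dual_idem_mats)
  fix v
  have "cut {x} v = (\<lambda>y. v x * ind {x} y)" by (auto simp: cut_def ind_def)
  then have "mvmult X M (cut {x} v) = (\<lambda>y. v x * mvmult X M (ind {x}) y)"
    using lin_on_smult[OF lin_on_mvmult[of UNIV], of "ind {x}"] by simp
  then show "mvmult X (mmult X (dual_idem X E x 0) (mmult X M (dual_idem X E x 0))) v
      = mvmult X (\<lambda>y z. mvmult X M (ind {x}) x * dual_idem X E x 0 y z) v"
    by (simp add: mvmult_mmult mvmult_smult dual_idem_0[OF assms(1)] cut_def fun_eq_iff)
qed

text \<open>Numbers of closed walks at \<open>x\<close>, each written as an inner product on the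
  sphere indicators. The one of length four is the squared norm of \<open>A (ind D1)\<close>, whose
  values on the three spheres are k, a and c.\<close>

lemma closed_walks:
  "A (A (ind {x})) x = of_nat k"
  "A (A (A (ind {x}))) x = of_nat k * of_nat a"
  "A (A (A (A (ind {x})))) x = of_nat k * of_nat k + of_nat k * of_nat a * of_nat a
    + of_nat (n - Suc k) * of_nat c * of_nat c"
proof -
  have d: "ip X (ind D1) (ind {x}) = 0" "ip X (ind D1) (ind D2) = 0" "ip X (ind D2) (ind {x}) = 0"
    "ip X (ind D2) (ind D1) = 0" "ip X (ind {x}) (ind D1) = 0" "ip X (ind {x}) (ind D2) = 0"
    using x_notin_D1 xD2 D12 by (auto intro!: ip_disjoint ind_vecs)
  have s: "ip X (ind D1) (ind D1) = of_nat k" "ip X (ind D2) (ind D2) = of_nat (n - Suc k)"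
    "ip X (ind {x}) (ind {x}) = 1"
    using x card_D1 card_D2 D1_sub D2_sub by (simp_all add: ip_ind) (simp_all add: ind_def)
  have e: "A (ind D1) = (\<lambda>y. 1 * (of_nat k * ind {x} y + of_nat a * ind D1 y) + of_nat c * ind D2 y)"
    by (simp add: A_ind_D1)
  show "A (A (ind {x})) x = of_nat k" by (simp add: A_at_x A_single s)
  show "A (A (A (ind {x}))) x = of_nat k * of_nat a"
    unfolding A_at_x A_single by (simp only: e ip_comb_right d s) simp
  show "A (A (A (A (ind {x})))) x = of_nat k * of_nat k + of_nat k * of_nat a * of_nat a
    + of_nat (n - Suc k) * of_nat c * of_nat c"
    unfolding A_at_x A_single A_self_adjoint[of _ "A (ind D1)"]
    by (simp only: e ip_comb_right ip_comb_left d s) simp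
qed

end

lemma srg_diameter:
  assumes srg: "strongly_regular X E n k a c" and conn: "connected_graph X E"
  shows "diameter X E = 2"
proof -
  have fin: "finite X" using srg by (simp add: strongly_regular_def simple_graph_def)
  have le: "gdist X E x y \<le> 2" if "x \<in> X" "y \<in> X" for x y
    using srg_vertex.gdist_eq[OF srg_vertex.intro[OF srg that(1)] conn that(2)] by simp
  obtain y z where yz: "y \<in> X" "z \<in> X" "y \<noteq> z" "\<not> E y z"
    using srg unfolding strongly_regular_def by blast
  then have "gdist X E y z = 2"
    using srg_vertex.gdist_eq[OF srg_vertex.intro[OF srg yz(1)] conn yz(2)] by simp
  with yz have "2 \<in> {gdist X E x y |x y. x \<in> X \<and> y \<in> X}" by (intro CollectI) metis
  moreover have "{gdist X E x y |x y. x \<in> X \<and> y \<in> X} \<subseteq> {..2}" using le by auto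
  ultimately show ?thesis unfolding diameter_def
    by (intro Max_eqI) (auto intro: finite_subset)
qed

section \<open>From equal local spectra to an intertwining map\<close>

lemma quadratic_two_roots:
  "\<exists>r s. \<forall>t::complex. t\<^sup>2 = p * t + q \<longrightarrow> t = r \<or> t = s"
proof -
  define d where "d = csqrt (p\<^sup>2 + 4 * q)"
  have d: "d * d = p\<^sup>2 + 4 * q" by (simp add: d_def power2_eq_square[symmetric])
  have "t = (p + d) / 2 \<or> t = (p - d) / 2" if "t\<^sup>2 = p * t + q" for t
  proof -
    have "(2 * t - p - d) * (2 * t - p + d) = 4 * t\<^sup>2 - 4 * p * t + p\<^sup>2 - d * d"
      by (simp add: algebra_simps power2_eq_square)
    also have "\<dots> = 0" using that d by (simp add: algebra_simps)
    finally have "2 * t - p - d = 0 \<or> 2 * t - p + d = 0" by simp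
    then show ?thesis by (auto simp: field_simps eq_diff_eq add_eq_0_iff2)
  qed
  then show ?thesis by blast
qed

text \<open>Basis vectors with the same index correspond. The generators act on both bases with the
  same coefficients: \<open>A\<close> through the parameters, \<open>ev\<close> and
  \<open>th\<close>, and each sphere projection as 1 or 0 according to \<open>lev\<close>.\<close>

lemma intertwine_basis:
  fixes J :: "'l set" and Q :: "'q set"
  assumes G: "srg_local X E n k a c x J u ev" and G': "srg_local X' E' n k a c x' J u' ev"
    and z: "orth_basis X (srg_local.perp X E x J u) Q z"
    and z': "orth_basis X' (srg_local.perp X' E' x' J u') Q z'"
    and th: "\<And>q. q \<in> Q \<Longrightarrow> mvmult X (adj_mat X E) (z q) = (\<lambda>y. th q * z q y)"
    and th': "\<And>q. q \<in> Q \<Longrightarrow> mvmult X' (adj_mat X' E') (z' q) = (\<lambda>y. th q * z' q y)"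
    and conn: "connected_graph X E" "connected_graph X' E'"
  shows "\<exists>\<rho> \<sigma>. lin_iso X X' \<rho> \<sigma>
      \<and> (\<forall>v\<in>vecs X. \<rho> (mvmult X (adj_mat X E) v) = mvmult X' (adj_mat X' E') (\<rho> v))
      \<and> (\<forall>i\<le>2. \<forall>v\<in>vecs X.
            \<rho> (mvmult X (dual_idem X E x i) v) = mvmult X' (dual_idem X' E' x' i) (\<rho> v))"
proof -
  interpret G: srg_local X E n k a c x J u ev by fact
  interpret G': srg_local X' E' n k a c x' J u' ev by fact
  let ?b = "G.fam z" and ?b' = "G'.fam z'"
  define I :: "('l, 'q) idx set" where "I = idx0 k a c J ev \<union> IZ ` Q"
  have I: "G.idx_all Q = I" "G'.idx_all Q = I" by (simp_all add: G.idx_all_def G'.idx_all_def I_def)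
  note b = G.fam_basis[OF z, unfolded I] and b' = G'.fam_basis[OF z', unfolded I]
  let ?\<rho> = "basis_map X I ?b ?b'" and ?\<sigma> = "basis_map X' I ?b' ?b"
  have iso: "lin_iso X X' ?\<rho> ?\<sigma>" by (rule basis_map_lin_iso[OF G.fin G'.fin b b'])
  have lin: "lin_on UNIV ?\<rho>" by (rule lin_on_basis_map)
  have \<rho>b: "?\<rho> (?b i) = ?b' i" if "i \<in> I" for i by (rule basis_map_basis[OF G.fin b subset_refl that])
  have \<rho>_vecs: "?\<rho> v \<in> vecs X'" if "v \<in> vecs X" for v using iso that by (simp add: lin_iso_def)
  have comb: "?\<rho> (\<lambda>y. s * v y + t * w y) = (\<lambda>y. s * ?\<rho> v y + t * ?\<rho> w y)" for s t v w
    by (intro lin_on_comb[OF lin]) auto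
  have 0: "?\<rho> (\<lambda>_. 0) = (\<lambda>_. 0)" using lin_on_smult[OF lin, of "\<lambda>_. 0" 0] by simp
  have b012: "?\<rho> (ind {x}) = ind {x'}" "?\<rho> (ind G.D1) = ind G'.D1" "?\<rho> (ind G.D2) = ind G'.D2"
    using \<rho>b[of X0] \<rho>b[of X1] \<rho>b[of X2] by (simp_all add: I_def idx0_def)
  have bu: "?\<rho> (u j) = u' j" if "j \<in> J" for j using \<rho>b[of "IU j"] that by (simp add: I_def idx0_def)
  \<comment> \<open>For \<open>srg_mu\<close> equal to zero there is no basis vector to match, but
    the \<open>W\<close> vectors of both graphs are zero.\<close>
  have bW: "?\<rho> (G.W j) = G'.W j" if j: "j \<in> J" for j
  proof (cases "srg_mu k a c (ev j) = 0")
    case True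
    then have "G.W j = (\<lambda>_. 0)" "G'.W j = (\<lambda>_. 0)" using G.W_eq_0_iff[OF j] G'.W_eq_0_iff[OF j] by auto
    with 0 show ?thesis by simp
  next
    case False
    with j \<rho>b[of "IW j"] show ?thesis by (simp add: I_def idx0_def)
  qed
  have A: "?\<rho> (G.A (?b i)) = G'.A (?\<rho> (?b i))" if i: "i \<in> I" for i
  proof (cases i)
    case X0
    then show ?thesis using b012 by (simp add: G.A_single G'.A_single)
  next
    case X1
    have e: "G.A (ind G.D1) = (\<lambda>y. 1 * (of_nat k * ind {x} y + of_nat a * ind G.D1 y) + of_nat c * ind G.D2 y)"
      by (simp add: G.A_ind_D1)
    have "?\<rho> (G.A (ind G.D1)) = G'.A (ind G'.D1)"
      unfolding e comb b012 by (simp add: G'.A_ind_D1)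
    with X1 b012 show ?thesis by simp
  next
    case X2
    have "?\<rho> (G.A (ind G.D2)) = G'.A (ind G'.D2)"
      unfolding G.A_ind_D2 G'.A_ind_D2 comb b012 by simp
    with X2 b012 show ?thesis by simp
  next
    case (IU j)
    with i have j: "j \<in> J" by (auto simp: I_def idx0_def)
    have "?\<rho> (G.A (u j)) = G'.A (u' j)"
      unfolding G.A_u[OF j] G'.A_u[OF j] using comb[of "ev j" "u j" 1 "G.W j"] bu[OF j] bW[OF j] by simp
    with IU bu[OF j] show ?thesis by simp
  next
    case (IW j)
    with i have j: "j \<in> J" by (auto simp: I_def idx0_def)
    have "?\<rho> (G.A (G.W j)) = G'.A (G'.W j)"
      unfolding G.A_W[OF j] G'.A_W[OF j] comb bu[OF j] bW[OF j] by simp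
    with IW bW[OF j] show ?thesis by simp
  next
    case (IZ q)
    with i have q: "q \<in> Q" by (auto simp: I_def idx0_def)
    have "?\<rho> (z q) = z' q" using \<rho>b[OF i] IZ by simp
    then have "?\<rho> (G.A (z q)) = G'.A (?\<rho> (z q))"
      using lin_on_smult[OF lin, of "z q"] by (simp add: th[OF q] th'[OF q])
    with IZ show ?thesis by simp
  qed
  have E: "?\<rho> (mvmult X (dual_idem X E x m) (?b i)) = mvmult X' (dual_idem X' E' x' m) (?\<rho> (?b i))"
    if i: "i \<in> I" and m: "m \<le> 2" for i m
  proof -
    have m3: "m = 0 \<or> m = 1 \<or> m = 2" using m by auto
    have cut: "mvmult X (dual_idem X E x m) v = cut (G.sphere m) v"
      "mvmult X' (dual_idem X' E' x' m) v' = cut (G'.sphere m) v'" for v v'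
      using m3 G.dual_idem_0[OF conn(1)] G.dual_idem_1[OF conn(1)] G.dual_idem_2[OF conn(1)]
        G'.dual_idem_0[OF conn(2)] G'.dual_idem_1[OF conn(2)] G'.dual_idem_2[OF conn(2)]
      by (auto simp: G.sphere_def G'.sphere_def)
    note bs = G.fam_sphere[OF z, unfolded I, OF i] and bs' = G'.fam_sphere[OF z', unfolded I, OF i]
    show ?thesis
    proof (cases "lev i = m")
      case True
      then show ?thesis unfolding cut \<rho>b[OF i] using cut_same[OF bs] cut_same[OF bs'] \<rho>b[OF i] by simp
    next
      case False
      then show ?thesis unfolding cut \<rho>b[OF i]
        using cut_disjoint[OF bs G.sphere_disjoint] cut_disjoint[OF bs' G'.sphere_disjoint] 0 by simp
    qed
  qed
  have "?\<rho> (G.A v) = G'.A (?\<rho> v)" if "v \<in> vecs X" for v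
    by (rule lin_intertwineI[OF G.fin b lin_on_basis_map adj_mat_mats A \<rho>_vecs that])
  moreover have "?\<rho> (mvmult X (dual_idem X E x m) v) = mvmult X' (dual_idem X' E' x' m) (?\<rho> v)"
    if "v \<in> vecs X" "m \<le> 2" for v m
    by (rule lin_intertwineI[OF G.fin b lin_on_basis_map dual_idem_mats E[OF _ that(2)] \<rho>_vecs that(1)])
  ultimately show ?thesis using iso by blast
qed

lemma orth_basis_reindex:
  assumes "bij_betw h I B" "orth_basis X S B b"
  shows "orth_basis X S I (\<lambda>i. b (h i))"
proof -
  have hB: "h i \<in> B" if "i \<in> I" for i using assms(1) that by (auto simp: bij_betw_def)
  have inj: "h i \<noteq> h j" if "i \<in> I" "j \<in> I" "i \<noteq> j" for i j
    using assms(1) that by (auto simp: bij_betw_def inj_on_def)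
  have "finite I" using assms bij_betw_finite by (auto simp: orth_basis_def)
  moreover have "v = (\<lambda>_. 0)" if "v \<in> S" "\<forall>i\<in>I. ip X (b (h i)) v = 0" for v
  proof -
    have "\<forall>i\<in>B. ip X (b i) v = 0" using that(2) assms(1) by (auto simp: bij_betw_def)
    with that(1) assms(2) show ?thesis by (simp add: orth_basis_def)
  qed
  ultimately show ?thesis using assms(2) hB inj by (simp add: orth_basis_def)
qed

lemma T_isomorphic_if_same_local_spectra:
  assumes srg: "strongly_regular X E n k a c" "strongly_regular X' E' n k a c"
    and conn: "connected_graph X E" "connected_graph X' E'"
    and spec: "\<And>x x'. x \<in> X \<Longrightarrow> x' \<in> X' \<Longrightarrow> local_spectrum X E x = local_spectrum X' E' x'"
  shows "T_isomorphic X E X' E'"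
proof (rule T_isomorphicI)
  show "finite X" "finite X'" "card X = card X'"
    using srg by (simp_all add: strongly_regular_def simple_graph_def)
  have D: "diameter X E = 2" "diameter X' E' = 2"
    using srg_diameter[OF srg(1) conn(1)] srg_diameter[OF srg(2) conn(2)] by auto
  then show "diameter X E = diameter X' E'" by simp
  fix x x' assume x: "x \<in> X" and x': "x' \<in> X'"
  interpret V: srg_vertex X E n k a c x by unfold_locales fact+
  interpret V': srg_vertex X' E' n k a c x' by unfold_locales fact+
  obtain J ev where J: "orth_basis X V.S1 J (\<lambda>b. b)" "\<forall>b\<in>J. cut V.D1 (V.A b) = (\<lambda>y. ev b * b y)"
    using V.local_eigenbasis by blast
  obtain J' ev' where J': "orth_basis X' V'.S1 J' (\<lambda>b. b)" "\<forall>b\<in>J'. cut V'.D1 (V'.A b) = (\<lambda>y. ev' b * b y)"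
    using V'.local_eigenbasis by blast
  interpret G: srg_local X E n k a c x J "\<lambda>b. b" ev using J by unfold_locales auto
  have "image_mset ev (mset_set J) = image_mset ev' (mset_set J')"
  proof -
    \<comment> \<open>The second graph is used here with its own eigenbasis \<open>J'\<close>, just
      to read off its local spectrum; the common summand \<open>of_nat a\<close> then
      cancels.\<close>
    interpret L: srg_local X' E' n k a c x' J' "\<lambda>b. b" ev' using J' by unfold_locales auto
    show ?thesis using spec[OF x x'] unfolding G.local_spectrum_eq L.local_spectrum_eq by simp
  qed
  then obtain h where h: "bij_betw h J J'" "\<forall>b\<in>J. ev' (h b) = ev b"
    using bij_betw_of_image_mset_eq[of J J' ev ev'] J(1) J'(1) by (auto simp: orth_basis_def)
  have hJ': "h b \<in> J'" if "b \<in> J" for b using h(1) that by (auto simp: bij_betw_def)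
  \<comment> \<open>The same eigenbasis relabelled by \<open>J\<close> through \<open>h\<close>.
    From here on both graphs have the same \<open>J\<close>, \<open>ev\<close> and parameters, and
    so the same \<open>idx0\<close>.\<close>
  interpret G': srg_local X' E' n k a c x' J h ev
    using orth_basis_reindex[OF h(1) J'(1)] J'(2) h(2) hJ' by unfold_locales auto
  obtain Z th where Z: "orth_basis X G.perp Z (\<lambda>b. b)" "\<And>b. b \<in> Z \<Longrightarrow> V.A b = (\<lambda>y. th b * b y)"
    "\<And>b. b \<in> Z \<Longrightarrow> (th b)\<^sup>2 = (of_nat a - of_nat c) * th b + (of_nat k - of_nat c)"
    using G.perp_eigenbasis by blast
  obtain Z' th' where Z': "orth_basis X' G'.perp Z' (\<lambda>b. b)" "\<And>b. b \<in> Z' \<Longrightarrow> V'.A b = (\<lambda>y. th' b * b y)"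
    "\<And>b. b \<in> Z' \<Longrightarrow> (th' b)\<^sup>2 = (of_nat a - of_nat c) * th' b + (of_nat k - of_nat c)"
    using G'.perp_eigenbasis by blast
  have "image_mset th (mset_set Z) = image_mset th' (mset_set Z')"
  proof -
    obtain r s where rs: "\<forall>t::complex. t\<^sup>2 = (of_nat a - of_nat c) * t + (of_nat k - of_nat c) \<longrightarrow> t = r \<or> t = s"
      using quadratic_two_roots by blast
    show ?thesis
    proof (rule image_mset_eq_two_values[where r = r and s = s])
      show "card Z = card Z'" using G.card_Q[OF Z(1)] G'.card_Q[OF Z'(1)] by simp
      \<comment> \<open>Both sides are zero by \<open>sum_th\<close>, and they agree in every term
        except the sum over the remaining eigenvalues.\<close>
      have "of_nat a + (of_nat k - of_nat c) + (\<Sum>j\<in>J. ev j)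
          + (\<Sum>j | j \<in> J \<and> srg_mu k a c (ev j) \<noteq> 0. of_nat a - of_nat c - ev j) + sum th Z
        = of_nat a + (of_nat k - of_nat c) + (\<Sum>j\<in>J. ev j)
          + (\<Sum>j | j \<in> J \<and> srg_mu k a c (ev j) \<noteq> 0. of_nat a - of_nat c - ev j) + sum th' Z'"
        by (rule trans[OF G.sum_th[OF Z(1,2)] G'.sum_th[OF Z'(1,2), symmetric]])
      then show "sum th Z = sum th' Z'" by (simp only: add_left_cancel)
    qed (use rs Z(3) Z'(3) Z(1) Z'(1) in \<open>auto simp: orth_basis_def\<close>)
  qed
  then obtain g where g: "bij_betw g Z Z'" "\<forall>b\<in>Z. th' (g b) = th b"
    using bij_betw_of_image_mset_eq[of Z Z' th th'] Z(1) Z'(1) by (auto simp: orth_basis_def)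
  have gZ': "g b \<in> Z'" if "b \<in> Z" for b using g(1) that by (auto simp: bij_betw_def)
  show "\<exists>\<rho> \<sigma>. lin_iso X X' \<rho> \<sigma>
      \<and> (\<forall>v\<in>vecs X. \<rho> (mvmult X (adj_mat X E) v) = mvmult X' (adj_mat X' E') (\<rho> v))
      \<and> (\<forall>i\<le>diameter X E. \<forall>v\<in>vecs X.
            \<rho> (mvmult X (dual_idem X E x i) v) = mvmult X' (dual_idem X' E' x' i) (\<rho> v))"
    unfolding D
    by (rule intertwine_basis[OF G.srg_local_axioms G'.srg_local_axioms Z(1)
        orth_basis_reindex[OF g(1) Z'(1)] Z(2) _ conn])
      (use Z'(2) g(2) gZ' in auto)
qed

section \<open>From a T-isomorphism to the parameters and the local spectrum\<close>

lemma T_isomorphic_imp_parameters_local_spectrum: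
  assumes srg: "strongly_regular X E n k a c" "strongly_regular X' E' n' k' a' c'"
    and conn: "connected_graph X E" "connected_graph X' E'"
    and iso: "T_isomorphic X E X' E'" and x: "x \<in> X" and x': "x' \<in> X'"
  shows "(n, k, a, c) = (n', k', a', c') \<and> local_spectrum X E x = local_spectrum X' E' x'"
proof -
  interpret G: srg_vertex X E n k a c x by unfold_locales fact+
  interpret G': srg_vertex X' E' n' k' a' c' x' by unfold_locales fact+
  note D = srg_diameter[OF srg(1) conn(1)]
  let ?T = "T_alg X E x" and ?T' = "T_alg X' E' x'"
  from iso[unfolded T_isomorphic_def D, THEN conjunct2, rule_format, OF x x']
  obtain f \<rho> where card: "card X = card X'" and f: "bij_betw f ?T ?T'"
    and f_smult_all: "\<forall>s. \<forall>M\<in>?T. f (\<lambda>y z. s * M y z) = (\<lambda>y z. s * f M y z)"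
    and f_mult_all: "\<forall>M\<in>?T. \<forall>N\<in>?T. f (mmult X M N) = mmult X' (f M) (f N)"
    and f_A: "f (adj_mat X E) = adj_mat X' E'"
    and f_E_all: "\<forall>i\<le>2. f (dual_idem X E x i) = dual_idem X' E' x' i"
    and \<rho>: "bij_betw \<rho> (vecs X) (vecs X')"
    and \<rho>_add_all: "\<forall>u\<in>vecs X. \<forall>v\<in>vecs X. \<rho> (\<lambda>y. u y + v y) = (\<lambda>y. \<rho> u y + \<rho> v y)"
    and \<rho>_smult_all: "\<forall>s. \<forall>v\<in>vecs X. \<rho> (\<lambda>y. s * v y) = (\<lambda>y. s * \<rho> v y)"
    and \<rho>_T_all: "\<forall>B\<in>?T. \<forall>v\<in>vecs X. \<rho> (mvmult X B v) = mvmult X' (f B) (\<rho> v)"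
    by (elim conjE exE) (rule that; assumption)
  note f_smult = f_smult_all[rule_format] and f_mult = f_mult_all[rule_format]
    and f_E = f_E_all[rule_format] and \<rho>_add = \<rho>_add_all[rule_format]
    and \<rho>_smult = \<rho>_smult_all[rule_format] and \<rho>_T = \<rho>_T_all[rule_format]
  have fT: "f M \<in> ?T'" if "M \<in> ?T" for M using f that by (auto simp: bij_betw_def)
  have E0: "dual_idem X E x 0 \<in> ?T" and E1: "dual_idem X E x 1 \<in> ?T"
    by (auto intro!: T_alg.gen_E simp: D)
  \<comment> \<open>Compressing \<open>M\<close> by \<open>dual_idem\<close> at 0 yields its (x, x)
    entry times that idempotent. Since \<open>f\<close> respects the compression and the idempotent,
    the diagonal entries of \<open>M\<close> and \<open>f M\<close> agree.\<close>
  have diag: "mvmult X M (ind {x}) x = mvmult X' (f M) (ind {x'}) x'" if M: "M \<in> ?T" for M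
  proof -
    have "(\<lambda>y z. mvmult X M (ind {x}) x * dual_idem X' E' x' 0 y z)
      = f (\<lambda>y z. mvmult X M (ind {x}) x * dual_idem X E x 0 y z)"
      using f_smult[OF E0] f_E[of 0] by simp
    also have "\<dots> = f (mmult X (dual_idem X E x 0) (mmult X M (dual_idem X E x 0)))"
      by (simp add: G.compress_dual_idem_0[OF conn(1) T_alg_mats[OF M]])
    also have "\<dots> = mmult X' (dual_idem X' E' x' 0) (mmult X' (f M) (dual_idem X' E' x' 0))"
      using M E0 f_E[of 0] by (simp add: f_mult T_alg.mult)
    also have "\<dots> = (\<lambda>y z. mvmult X' (f M) (ind {x'}) x' * dual_idem X' E' x' 0 y z)"
      by (rule G'.compress_dual_idem_0[OF conn(2) T_alg_mats[OF fT[OF M]]])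
    finally have eq: "(\<lambda>y z. mvmult X M (ind {x}) x * dual_idem X' E' x' 0 y z)
      = (\<lambda>y z. mvmult X' (f M) (ind {x'}) x' * dual_idem X' E' x' 0 y z)" .
    from fun_cong[OF fun_cong[OF eq, of x'], of x']
    have "mvmult X M (ind {x}) x * dual_idem X' E' x' 0 x' x'
        = mvmult X' (f M) (ind {x'}) x' * dual_idem X' E' x' 0 x' x'" .
    moreover have "dual_idem X' E' x' 0 x' x' = 1"
      using x' G'.gdist_eq[OF conn(2) x'] by (simp add: dual_idem_def)
    ultimately show ?thesis by simp
  qed
  let ?A = "adj_mat X E" and ?A' = "adj_mat X' E'"
  note T = T_alg.gen_A[of X E x] T_alg.mult
  have A2: "mmult X ?A ?A \<in> ?T" "f (mmult X ?A ?A) = mmult X' ?A' ?A'"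
    by (auto intro: T simp: f_mult f_A T)
  then have A3: "mmult X ?A (mmult X ?A ?A) \<in> ?T"
    "f (mmult X ?A (mmult X ?A ?A)) = mmult X' ?A' (mmult X' ?A' ?A')"
    by (auto intro: T simp: f_mult f_A T)
  then have A4: "mmult X ?A (mmult X ?A (mmult X ?A ?A)) \<in> ?T"
    "f (mmult X ?A (mmult X ?A (mmult X ?A ?A))) = mmult X' ?A' (mmult X' ?A' (mmult X' ?A' ?A'))"
    by (auto intro: T simp: f_mult f_A T)
  have n: "n = n'" using card G.card_X G'.card_X by simp
  have "(of_nat k :: complex) = of_nat k'"
    using diag[OF A2(1)] by (simp only: A2(2) mvmult_mmult G.closed_walks G'.closed_walks)
  then have k: "k = k'" by (simp only: of_nat_eq_iff)
  have "(of_nat (k * a) :: complex) = of_nat (k' * a')"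
    using diag[OF A3(1)] by (simp only: A3(2) mvmult_mmult G.closed_walks G'.closed_walks of_nat_mult)
  then have a: "a = a'" using k G.k_pos by (simp only: of_nat_eq_iff) simp
  have "(of_nat (k * k + k * a * a + (n - Suc k) * c * c) :: complex)
      = of_nat (k' * k' + k' * a' * a' + (n' - Suc k') * c' * c')"
    using diag[OF A4(1)]
    by (simp only: A4(2) mvmult_mmult G.closed_walks G'.closed_walks of_nat_mult of_nat_add)
  \<comment> \<open>Cancelling the terms in the known k and a leaves the contribution of the second
    sphere, whose size is positive by \<open>n_gt\<close>; this recovers c up to sign, hence
    c.\<close>
  then have "(n - Suc k) * (c * c) = (n - Suc k) * (c' * c')"
    unfolding of_nat_eq_iff using n k a by (simp add: mult.assoc)
  then have "c ^ 2 = c' ^ 2" using G.n_gt by (simp add: power2_eq_square)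
  then have c: "c = c'" by (simp add: power2_eq_iff_nonneg)
  have lin: "lin_on (vecs X) \<rho>"
    unfolding lin_on_def
  proof (intro ballI allI)
    fix u v s t assume "u \<in> vecs X" "v \<in> vecs X"
    then show "\<rho> (\<lambda>y. s * u y + t * v y) = (\<lambda>y. s * \<rho> u y + t * \<rho> v y)"
      using \<rho>_add[of "\<lambda>y. s * u y" "\<lambda>y. t * v y"] subsp_smult[OF subsp_vecs[of X]] by (simp add: \<rho>_smult)
  qed
  define \<sigma> where "\<sigma> = inv_into (vecs X) \<rho>"
  have iso_X: "lin_iso X X' \<rho> \<sigma>" unfolding \<sigma>_def by (rule lin_isoI_bij[OF \<rho> lin])
  \<comment> \<open>The projection onto \<open>D1\<close> is the action of an element of the
    algebra, so \<rho> carries it to the projection onto the other neighbourhood.\<close>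
  have cut: "\<rho> (cut G.D1 v) = cut G'.D1 (\<rho> v)" if "v \<in> vecs X" for v
    using \<rho>_T[OF E1 that] f_E[of 1] G.dual_idem_1[OF conn(1)] G'.dual_idem_1[OF conn(2)] by simp
  have D1X: "v \<in> vecs X" if "v \<in> vecs G.D1" for v using vecs_mono[OF that G.D1_sub] .
  have D1X': "v \<in> vecs X'" if "v \<in> vecs G'.D1" for v using vecs_mono[OF that G'.D1_sub] .
  have \<rho>1: "\<rho> v \<in> vecs G'.D1" if "v \<in> vecs G.D1" for v
    using cut[OF D1X[OF that]] cut_vecs[of G'.D1 "\<rho> v"] by (simp add: cut_same[OF that])
  \<comment> \<open>The vector \<open>\<sigma> v\<close> and its cut to \<open>D1\<close> have the
    same image under \<rho>, so they coincide by injectivity.\<close>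
  have \<sigma>1: "\<sigma> v \<in> vecs G.D1" if "v \<in> vecs G'.D1" for v
  proof -
    have \<sigma>v: "\<sigma> v \<in> vecs X" "\<rho> (\<sigma> v) = v" using iso_X D1X'[OF that] by (auto simp: lin_iso_def)
    then have "\<rho> (cut G.D1 (\<sigma> v)) = v" using cut[OF \<sigma>v(1)] cut_same[OF that] by simp
    moreover have "\<sigma> (\<rho> (cut G.D1 (\<sigma> v))) = cut G.D1 (\<sigma> v)"
      using iso_X D1X[OF cut_vecs] by (auto simp: lin_iso_def)
    ultimately have "\<sigma> v = cut G.D1 (\<sigma> v)" by simp
    then show ?thesis using cut_vecs[of G.D1 "\<sigma> v"] by simp
  qed
  have iso_D1: "lin_iso G.D1 G'.D1 \<rho> \<sigma>"
    using iso_X \<rho>1 \<sigma>1 D1X D1X' unfolding lin_iso_def lin_on_def by auto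
  have "\<rho> (\<lambda>y. if y \<in> G.D1 then mvmult G.D1 ?A v y else 0)
      = (\<lambda>y. if y \<in> G'.D1 then mvmult G'.D1 ?A' (\<rho> v) y else 0)" if v: "v \<in> vecs G.D1" for v
    using cut[OF G.A_vecs, of v] \<rho>_T[OF T_alg.gen_A D1X[OF v]]
    unfolding G.A_local[OF v] G'.A_local[OF \<rho>1[OF v]] by (simp add: f_A cut_def)
  moreover obtain vs where vs: "distinct vs" "set vs = G.D1"
    and spec: "local_spectrum X E x = proots (char_poly (mat_on vs ?A))"
    by (rule G.local_spectrum_mat_on)
  moreover obtain vs' where vs': "distinct vs'" "set vs' = G'.D1"
    and spec': "local_spectrum X' E' x' = proots (char_poly (mat_on vs' ?A'))"
    by (rule G'.local_spectrum_mat_on)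
  moreover have "card G.D1 = card G'.D1" using G.card_D1 G'.card_D1 k by simp
  ultimately have "char_poly (mat_on vs ?A) = char_poly (mat_on vs' ?A')"
    using char_poly_lin_iso[OF vs vs' _ iso_D1, of ?A ?A'] by blast
  then show ?thesis using n k a c spec spec' by simp
qed

theorem theorem5p12:
  fixes X :: "'a set" and E :: "'a \<Rightarrow> 'a \<Rightarrow> bool"
    and X' :: "'b set" and E' :: "'b \<Rightarrow> 'b \<Rightarrow> bool"
    and n k a c n' k' a' c' :: nat
  assumes "strongly_regular X E n k a c" and "connected_graph X E"
    and "strongly_regular X' E' n' k' a' c'" and "connected_graph X' E'"
  shows "T_isomorphic X E X' E' \<longleftrightarrow>
    ((n, k, a, c) = (n', k', a', c') \<and>
     (\<forall>x\<in>X. \<forall>x'\<in>X'. local_spectrum X E x = local_spectrum X' E' x'))"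
proof
  assume iso: "T_isomorphic X E X' E'"
  \<comment> \<open>\<open>T_isomorphic\<close> quantifies over pairs of vertices, so equality of
    the parameters is extracted from one such pair; the non-adjacent pairs show that both vertex
    sets are nonempty.\<close>
  have "\<exists>x\<in>X. \<exists>y\<in>X. x \<noteq> y \<and> \<not> E x y" "\<exists>x\<in>X'. \<exists>y\<in>X'. x \<noteq> y \<and> \<not> E' x y"
    using assms(1,3) by (simp_all add: strongly_regular_def)
  then obtain x x' where "x \<in> X" "x' \<in> X'" by auto
  then show "(n, k, a, c) = (n', k', a', c') \<and>
     (\<forall>x\<in>X. \<forall>x'\<in>X'. local_spectrum X E x = local_spectrum X' E' x')"
    using T_isomorphic_imp_parameters_local_spectrum[OF assms(1,3,2,4) iso] by blast
next
  assume "(n, k, a, c) = (n', k', a', c') \<and>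
     (\<forall>x\<in>X. \<forall>x'\<in>X'. local_spectrum X E x = local_spectrum X' E' x')"
  then show "T_isomorphic X E X' E'"
    using T_isomorphic_if_same_local_spectra[of X E n k a c X' E'] assms by simp
qed

end
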